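(* Let $G$ be a finite simple graph, let $\mathrm{k}$ be a field, and let $S$ be the polynomial ring over $\mathrm{k}$ whose variables are the vertices of $G$. Let $t \ge 1$ and let $\mathbf{e} = \{e_1,\ldots,e_t\}$ be a set of $t$ distinct edges of $G$. Assume that $G[\mathbf{e}]$ is bipartite, that $G[\bar{\mathbf{e}}]$ is weakly chordal, and that $\mathbf{e}$, viewed as a subgraph of $G$, is connected. Let $R$ be the polynomial ring over $\mathrm{k}$ whose variables are the vertices of $G[\bar{\mathbf{e}}]$. Then $$\operatorname{depth} S/I(G)^{t+1} \le 1 + \operatorname{depth} R/I(G[\bar{\mathbf{e}}]).$$
   Context: The edge ideal $I(G)$ of a graph $G$ is the ideal, in the polynomial ring over $\mathrm{k}$ whose variables are the vertices of $G$, generated by the products $uv$ where $\{u,v\}$ is an edge of $G$ (it is the zero ideal if $G$ has no edges). Depth is taken with respect to the maximal homogeneous ideal $\mathfrak m$ of the polynomial ring (generated by all variables): $\operatorname{depth}(L) = \min\{i \mid H^i_{\mathfrak m}(L)\ne 0\}$. For a vertex $x$, $N_G[x]$ is the closed neighbourhood, consisting of $x$ and all its neighbours. For a set $\mathbf{e}=\{e_1,\ldots,e_t\}$ of edges, viewed also as the subgraph of $G$ with edge set $\{e_1,\ldots,e_t\}$ and vertex set the endpoints of these edges, $N[\mathbf{e}] = \bigcup N_G[x]$, the union over all vertices $x$ belonging to some $e_j$. $G[\mathbf{e}]$ denotes the induced subgraph of $G$ on $N[\mathbf{e}]$, and $G[\bar{\mathbf{e}}]$ denotes the induced subgraph of $G$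 on $V(G)\setminus N[\mathbf{e}]$. A graph is weakly chordal if neither it nor its complement contains an induced cycle of length at least $5$. *)

theory Defs
  imports
    "HOL-Algebra.Ideal_Product"
    "HOL-Algebra.Module"
    "HOL-Library.Poly_Mapping"
    "HOL-Library.Extended_Nat"
    "HOL-Library.FuncSet"
begin

section \<open>Finite simple graphs\<close>

record 'v graph =
  verts :: "'v set"
  edges :: "'v set set"

definition finite_simple_graph :: "'v graph \<Rightarrow> bool" where
  "finite_simple_graph G \<longleftrightarrow>
     finite (verts G) \<and> (\<forall>e\<in>edges G. e \<subseteq> verts G \<and> card e = 2)"

definition induced_subgraph :: "'v graph \<Rightarrow> 'v set \<Rightarrow> 'v graph" where
  "induced_subgraph G W =
     \<lparr>verts = verts G \<inter> W, edges = {e \<in> edges G. e \<subseteq> W}\<rparr>"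

definition complement_graph :: "'v graph \<Rightarrow> 'v graph" where
  "complement_graph G =
     \<lparr>verts = verts G,
      edges = {{u, v} | u v. u \<in> verts G \<and> v \<in> verts G \<and> u \<noteq> v \<and> {u, v} \<notin> edges G}\<rparr>"

definition closed_nbhd :: "'v graph \<Rightarrow> 'v \<Rightarrow> 'v set" where
  "closed_nbhd G x = insert x {y. {x, y} \<in> edges G}"

definition closed_nbhd_edges :: "'v graph \<Rightarrow> 'v set set \<Rightarrow> 'v set" where
  "closed_nbhd_edges G es = (\<Union>x\<in>\<Union>es. closed_nbhd G x)"

definition edge_subgraph :: "'v set set \<Rightarrow> 'v graph" where
  "edge_subgraph es = \<lparr>verts = \<Union>es, edges = es\<rparr>"

definition bipartite :: "'v graph \<Rightarrow> bool" where
  "bipartite G \<longleftrightarrow>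
     (\<exists>A B. A \<union> B = verts G \<and> A \<inter> B = {} \<and>
        (\<forall>e\<in>edges G. \<exists>a\<in>A. \<exists>b\<in>B. e = {a, b}))"

definition connected_graph :: "'v graph \<Rightarrow> bool" where
  "connected_graph G \<longleftrightarrow>
     verts G \<noteq> {} \<and> (\<forall>u\<in>verts G. \<forall>v\<in>verts G. (\<lambda>x y. {x, y} \<in> edges G)\<^sup>*\<^sup>* u v)"

definition induced_cycle :: "'v graph \<Rightarrow> 'v list \<Rightarrow> bool" where
  "induced_cycle G cs \<longleftrightarrow>
     3 \<le> length cs \<and> distinct cs \<and> set cs \<subseteq> verts G \<and>
     (\<forall>i j. i < j \<and> j < length cs \<longrightarrow>
        ({cs ! i, cs ! j} \<in> edges G \<longleftrightarrow> j = i + 1 \<or> (i = 0 \<and> j = length cs - 1)))"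

definition weakly_chordal :: "'v graph \<Rightarrow> bool" where
  "weakly_chordal G \<longleftrightarrow>
     \<not> (\<exists>cs. 5 \<le> length cs \<and> (induced_cycle G cs \<or> induced_cycle (complement_graph G) cs))"


section \<open>Quotient modules and localization\<close>

text \<open>
  In the module records built below, the fields \<open>mult\<close> and \<open>one\<close>, which a module inherits
  from the ring record, carry no information and are left undefined.
\<close>

definition regular_module :: "('r, 'x) ring_scheme \<Rightarrow> ('r, 'r) module" where
  "regular_module A =
     \<lparr>carrier = carrier A, mult = undefined, one = undefined,
      zero = \<zero>\<^bsub>A\<^esub>, add = (\<oplus>\<^bsub>A\<^esub>), smult = (\<otimes>\<^bsub>A\<^esub>)\<rparr>"

definition quotient_module :: "('r, 'm, 'x) module_scheme \<Rightarrow> 'm set \<Rightarrow> ('r, 'm set) module" where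
  "quotient_module M N =
     \<lparr>carrier = a_rcosets\<^bsub>M\<^esub> N, mult = undefined, one = undefined,
      zero = N, add = set_add M,
      smult = (\<lambda>r X. \<Union>x\<in>X. N +>\<^bsub>M\<^esub> (r \<odot>\<^bsub>M\<^esub> x))\<rparr>"

text \<open>\<open>frac A M f x a\<close> is the fraction \<open>x / f\<^sup>a\<close> in the localization \<open>M\<^sub>f\<close>.\<close>

definition frac_rel ::
    "('r, 'x) ring_scheme \<Rightarrow> ('r, 'm, 'y) module_scheme \<Rightarrow> 'r \<Rightarrow> (('m \<times> nat) \<times> ('m \<times> nat)) set"
  where
  "frac_rel A M f =
     {((x, a), (y, b)). x \<in> carrier M \<and> y \<in> carrier M \<and>
        (\<exists>k::nat. (f [^]\<^bsub>A\<^esub> (k + b)) \<odot>\<^bsub>M\<^esub> x = (f [^]\<^bsub>A\<^esub> (k + a)) \<odot>\<^bsub>M\<^esub> y)}"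

definition frac ::
    "('r, 'x) ring_scheme \<Rightarrow> ('r, 'm, 'y) module_scheme \<Rightarrow> 'r \<Rightarrow> 'm \<Rightarrow> nat \<Rightarrow> ('m \<times> nat) set"
  where
  "frac A M f x a = frac_rel A M f `` {(x, a)}"

definition localization ::
    "('r, 'x) ring_scheme \<Rightarrow> ('r, 'm, 'y) module_scheme \<Rightarrow> 'r \<Rightarrow> ('r, ('m \<times> nat) set) module"
  where
  "localization A M f =
     \<lparr>carrier = (carrier M \<times> UNIV) // frac_rel A M f, mult = undefined, one = undefined,
      zero = frac A M f \<zero>\<^bsub>M\<^esub> 0,
      add = (\<lambda>X Y. \<Union>(x, a)\<in>X. \<Union>(y, b)\<in>Y.
        frac A M f (((f [^]\<^bsub>A\<^esub> b) \<odot>\<^bsub>M\<^esub> x) \<oplus>\<^bsub>M\<^esub> ((f [^]\<^bsub>A\<^esub> a) \<odot>\<^bsub>M\<^esub> y)) (a + b)),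
      smult = (\<lambda>r X. \<Union>(x, a)\<in>X. frac A M f (r \<odot>\<^bsub>M\<^esub> x) a)\<rparr>"

text \<open>
  For \<open>h = f g\<close>, the canonical map \<open>M\<^sub>f \<rightarrow> M\<^sub>h\<close> sends \<open>x / f\<^sup>a\<close> to \<open>g\<^sup>a x / h\<^sup>a\<close>.
\<close>

definition further_localize ::
    "('r, 'x) ring_scheme \<Rightarrow> ('r, 'm, 'y) module_scheme \<Rightarrow> 'r \<Rightarrow> 'r \<Rightarrow>
      ('m \<times> nat) set \<Rightarrow> ('m \<times> nat) set"
  where
  "further_localize A M g h X = (\<Union>(x, a)\<in>X. frac A M h ((g [^]\<^bsub>A\<^esub> a) \<odot>\<^bsub>M\<^esub> x) a)"


section \<open>Local cohomology and depth\<close>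

text \<open>
  The local cohomology \<open>H\<^sup>i\<^sub>J(M)\<close> of a module over a (Noetherian) ring, for the ideal \<open>J\<close>
  generated by \<open>f\<^sub>0, \<dots>, f\<^sub>n\<^sub>-\<^sub>1\<close>, is the cohomology of the extended Cech complex
  \<open>0 \<rightarrow> M \<rightarrow> \<Oplus>\<^sub>i M\<^bsub>f\<^sub>i\<^esub> \<rightarrow> \<Oplus>\<^bsub>i<j\<^esub> M\<^bsub>f\<^sub>i f\<^sub>j\<^esub> \<rightarrow> \<dots> \<rightarrow> M\<^bsub>f\<^sub>0 \<dots> f\<^sub>n\<^sub>-\<^sub>1\<^esub> \<rightarrow> 0\<close>,
  with \<open>M\<close> in degree \<open>0\<close>. The summands in degree \<open>p\<close> are indexed by the \<open>p\<close>-element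
  subsets of \<open>{0, \<dots>, n - 1}\<close>.
\<close>

definition cech_index :: "nat \<Rightarrow> nat \<Rightarrow> nat set set" where
  "cech_index n p = {\<sigma>. \<sigma> \<subseteq> {..<n} \<and> card \<sigma> = p}"

definition cech_elem :: "('r, 'x) ring_scheme \<Rightarrow> 'r list \<Rightarrow> nat set \<Rightarrow> 'r" where
  "cech_elem A fs \<sigma> = (\<Otimes>\<^bsub>A\<^esub>i\<in>\<sigma>. fs ! i)"

abbreviation cech_summand ::
    "('r, 'x) ring_scheme \<Rightarrow> 'r list \<Rightarrow> ('r, 'm, 'y) module_scheme \<Rightarrow> nat set \<Rightarrow>
      ('r, ('m \<times> nat) set) module"
  where
  "cech_summand A fs M \<sigma> \<equiv> localization A M (cech_elem A fs \<sigma>)"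

definition cech_module ::
    "('r, 'x) ring_scheme \<Rightarrow> 'r list \<Rightarrow> ('r, 'm, 'y) module_scheme \<Rightarrow> nat \<Rightarrow>
      ('r, nat set \<Rightarrow> ('m \<times> nat) set) module"
  where
  "cech_module A fs M p =
     \<lparr>carrier = (\<Pi>\<^sub>E \<sigma>\<in>cech_index (length fs) p. carrier (cech_summand A fs M \<sigma>)),
      mult = undefined, one = undefined,
      zero = (\<lambda>\<sigma>\<in>cech_index (length fs) p. \<zero>\<^bsub>cech_summand A fs M \<sigma>\<^esub>),
      add = (\<lambda>c d. \<lambda>\<sigma>\<in>cech_index (length fs) p. c \<sigma> \<oplus>\<^bsub>cech_summand A fs M \<sigma>\<^esub> d \<sigma>),
      smult = (\<lambda>r c. \<lambda>\<sigma>\<in>cech_index (length fs) p. r \<odot>\<^bsub>cech_summand A fs M \<sigma>\<^esub> c \<sigma>)\<rparr>"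

definition signed :: "('m, 'y) ring_scheme \<Rightarrow> nat \<Rightarrow> 'm \<Rightarrow> 'm" where
  "signed M n x = (if even n then x else \<ominus>\<^bsub>M\<^esub> x)"

definition cech_diff ::
    "('r, 'x) ring_scheme \<Rightarrow> 'r list \<Rightarrow> ('r, 'm, 'y) module_scheme \<Rightarrow> nat \<Rightarrow>
      (nat set \<Rightarrow> ('m \<times> nat) set) \<Rightarrow> (nat set \<Rightarrow> ('m \<times> nat) set)"
  where
  "cech_diff A fs M p c =
     (\<lambda>\<sigma>\<in>cech_index (length fs) (Suc p).
        \<Oplus>\<^bsub>cech_summand A fs M \<sigma>\<^esub>j\<in>\<sigma>.
          signed (cech_summand A fs M \<sigma>) (card {i \<in> \<sigma>. i < j})
            (further_localize A M (fs ! j) (cech_elem A fs \<sigma>) (c (\<sigma> - {j}))))"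

definition cech_cocycles ::
    "('r, 'x) ring_scheme \<Rightarrow> 'r list \<Rightarrow> ('r, 'm, 'y) module_scheme \<Rightarrow> nat \<Rightarrow>
      (nat set \<Rightarrow> ('m \<times> nat) set) set"
  where
  "cech_cocycles A fs M p =
     a_kernel (cech_module A fs M p) (cech_module A fs M (Suc p)) (cech_diff A fs M p)"

fun cech_coboundaries ::
    "('r, 'x) ring_scheme \<Rightarrow> 'r list \<Rightarrow> ('r, 'm, 'y) module_scheme \<Rightarrow> nat \<Rightarrow>
      (nat set \<Rightarrow> ('m \<times> nat) set) set"
  where
  "cech_coboundaries A fs M 0 = {\<zero>\<^bsub>cech_module A fs M 0\<^esub>}"
| "cech_coboundaries A fs M (Suc p) = cech_diff A fs M p ` carrier (cech_module A fs M p)"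

definition local_cohomology ::
    "('r, 'x) ring_scheme \<Rightarrow> 'r list \<Rightarrow> nat \<Rightarrow> ('r, 'm, 'y) module_scheme \<Rightarrow>
      ('r, (nat set \<Rightarrow> ('m \<times> nat) set) set) module"
  where
  "local_cohomology A fs i M =
     quotient_module ((cech_module A fs M i)\<lparr>carrier := cech_cocycles A fs M i\<rparr>)
       (cech_coboundaries A fs M i)"

text \<open>The value is \<open>\<infinity>\<close> if all local cohomology modules vanish, e.g. for the zero module.\<close>

definition depth ::
    "('r, 'x) ring_scheme \<Rightarrow> 'r list \<Rightarrow> ('r, 'm, 'y) module_scheme \<Rightarrow> enat"
  where
  "depth A fs M =
     Inf {enat i | i. carrier (local_cohomology A fs i M) \<noteq> {\<zero>\<^bsub>local_cohomology A fs i M\<^esub>}}"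


section \<open>Polynomial rings and edge ideals\<close>

type_synonym ('v, 'k) mpolynomial = "('v \<Rightarrow>\<^sub>0 nat) \<Rightarrow>\<^sub>0 'k"

definition polynomial_ring :: "'v set \<Rightarrow> ('v, 'k::comm_ring_1) mpolynomial ring" where
  "polynomial_ring V =
     \<lparr>carrier = {p. \<forall>m\<in>Poly_Mapping.keys p. Poly_Mapping.keys m \<subseteq> V},
      mult = (*), one = 1, zero = 0, add = (+)\<rparr>"

definition variable :: "'v \<Rightarrow> ('v, 'k::comm_ring_1) mpolynomial" where
  "variable v = Poly_Mapping.single (Poly_Mapping.single v 1) 1"

definition edge_ideal :: "'v graph \<Rightarrow> ('v, 'k::comm_ring_1) mpolynomial set" where
  "edge_ideal G =
     Idl\<^bsub>polynomial_ring (verts G)\<^esub> {variable u * variable v | u v. {u, v} \<in> edges G}"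

text \<open>
  Depth with respect to the ideal generated by all variables in the finite set \<open>V\<close>.
  The order of the variables enters only through the signs in the Cech complex, and its
  cohomology does not depend on it up to isomorphism.
\<close>

definition polynomial_depth ::
    "'v set \<Rightarrow> (('v, 'k::comm_ring_1) mpolynomial, 'm, 'y) module_scheme \<Rightarrow> enat"
  where
  "polynomial_depth V M =
     depth (polynomial_ring V) (map variable (SOME vs. distinct vs \<and> set vs = V)) M"

end

theory Submission
  imports Defs "HOL-Library.Transitive_Closure_Table"
begin

text \<open>
  Cohomology classes of \<open>R/I(H)\<close> are suspended to classes of \<open>S/I(G)\<^sup>t\<^sup>+\<^sup>1\<close> in one degree higher.

  Let \<open>f\<close> be the product of the edges in \<open>es\<close>, let \<open>A \<union> B\<close> be the bipartition of \<open>N[es]\<close>, and put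
  \<open>J = I(G)\<^sup>t\<^sup>+\<^sup>1\<close> and \<open>K = I(H)\<close>. Three facts about \<open>f\<close> carry the proof.

  \<^item> \<open>f K \<subseteq> J\<close>, since \<open>f\<close> is a product of \<open>t\<close> edges.

  \<^item> \<open>x\<^sub>p x\<^sub>q f \<in> J\<close> for \<open>p \<in> A\<close> and \<open>q \<in> B\<close> (\<open>edge_multiple_cross\<close>): a neighbour of \<open>p\<close> and a neighbour
    of \<open>q\<close> are joined by a simple path in the connected graph \<open>es\<close>. Its length is odd, so the path
    prolonged by \<open>p\<close> and \<open>q\<close> has a perfect matching with one edge more than the matching inside
    the path that it replaces.

  \<^item> If \<open>m\<close> is a monomial in the variables of \<open>H\<close>, \<open>c\<close> is an endpoint of an edge in \<open>es\<close>, and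
    \<open>m f x\<^sub>c\<^sup>n \<in> J\<close>, then \<open>m \<in> K\<close> (\<open>edge_multiple_restrict\<close>): if \<open>c \<in> A\<close>, the degree of \<open>m f x\<^sub>c\<^sup>n\<close> in the
    endpoints that lie in \<open>B\<close> is only \<open>t\<close>, so one of the \<open>t + 1\<close> edges avoids these endpoints,
    and then it is an edge of \<open>H\<close>.

  By these facts, the part of the Cech complex of \<open>S/J\<close> whose degree in the variables of \<open>N[es]\<close> is
  that of \<open>f\<close> behaves like the cochain complex of a union of two cones with apexes \<open>a \<in> A\<close> and \<open>b \<in> B\<close>
  (endpoints of edges of \<open>es\<close>) that meet in the complex for \<open>H\<close>. As for an ordinary suspension, a
  cocycle \<open>z\<close> of \<open>R/K\<close> gives the cocycle \<open>w\<close> whose value at \<open>\<sigma> \<union> {p}\<close> is \<open>\<plusminus> f z(\<sigma>)\<close> for \<open>p \<in> A\<close>, and that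
  vanishes at the other index sets: the second fact makes it a cocycle. If \<open>w\<close> is the coboundary of
  \<open>y\<close>, then comparing \<open>w = \<delta>y\<close> at \<open>\<sigma> \<union> {a}\<close> and at \<open>\<sigma> \<union> {b}\<close>, in the degree of \<open>f\<close>, cancels the term
  \<open>y(\<sigma>)\<close> and leaves \<open>z\<close> as a coboundary; here the third fact is used. This is
  \<open>has_class_suspension\<close>, an argument about commutative rings.

  Everything takes place at the level of numerators: \<open>has_class\<close> says in terms of polynomials that the
  local cohomology in a given degree is nonzero (\<open>cohomology_nontrivial_iff_has_class\<close>), for any
  enumeration of the variables (\<open>polynomial_depth_has_class\<close>).
\<close>

section \<open>Localizing a quotient ring\<close>

text \<open>
  For a subring of a ring that is a type, the operations are those of the type, so that
  arithmetic in all localizations below reduces to arithmetic of numerators there.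
\<close>

definition subring_record :: "'r::comm_ring_1 set \<Rightarrow> 'r ring" where
  "subring_record C = \<lparr>carrier = C, mult = (*), one = 1, zero = 0, add = (+)\<rparr>"

locale quotient_of_subring =
  fixes C I :: "'r::comm_ring_1 set"
  assumes one_C: "1 \<in> C"
    and minus_C: "x \<in> C \<Longrightarrow> - x \<in> C"
    and add_C: "x \<in> C \<Longrightarrow> y \<in> C \<Longrightarrow> x + y \<in> C"
    and mult_C: "x \<in> C \<Longrightarrow> y \<in> C \<Longrightarrow> x * y \<in> C"
    and I_subset: "I \<subseteq> C"
    and zero_I: "0 \<in> I"
    and add_I: "x \<in> I \<Longrightarrow> y \<in> I \<Longrightarrow> x + y \<in> I"
    and mult_I: "c \<in> C \<Longrightarrow> x \<in> I \<Longrightarrow> c * x \<in> I"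
begin

abbreviation A where "A \<equiv> subring_record C"
abbreviation Q where "Q \<equiv> quotient_module (regular_module A) I"

lemma zero_C: "0 \<in> C"
  using zero_I I_subset by blast

lemma diff_C: "x \<in> C \<Longrightarrow> y \<in> C \<Longrightarrow> x - y \<in> C"
  using add_C[of x "- y"] minus_C by simp

lemma power_C: "x \<in> C \<Longrightarrow> x ^ n \<in> C"
  by (induction n) (auto intro: one_C mult_C)

lemma sum_C: "(\<And>i. i \<in> T \<Longrightarrow> g i \<in> C) \<Longrightarrow> sum g T \<in> C"
  by (induction T rule: infinite_finite_induct) (auto intro: zero_C add_C)

lemma prod_C: "(\<And>i. i \<in> T \<Longrightarrow> g i \<in> C) \<Longrightarrow> prod g T \<in> C"
  by (induction T rule: infinite_finite_induct) (auto intro: one_C mult_C)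

lemmas C_closed = zero_C one_C minus_C add_C diff_C mult_C power_C

lemma minus_I: "x \<in> I \<Longrightarrow> - x \<in> I"
  using mult_I[of "- 1" x] minus_C one_C by simp

lemma diff_I: "x \<in> I \<Longrightarrow> y \<in> I \<Longrightarrow> x - y \<in> I"
  using add_I[of x "- y"] minus_I by simp

lemma cring_A: "cring A"
proof (rule cringI)
  show "abelian_group A"
    by (rule abelian_groupI)
      (auto simp: subring_record_def add_C zero_C algebra_simps
        intro!: bexI[of _ "- x" for x] minus_C)
  show "Group.comm_monoid A"
    by (rule comm_monoidI) (auto simp: subring_record_def mult_C one_C algebra_simps)
qed (auto simp: subring_record_def algebra_simps)

lemma pow_A: "x [^]\<^bsub>A\<^esub> (n::nat) = x ^ n"
  by (induction n) (simp_all add: nat_pow_def subring_record_def mult.commute)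

definition residue :: "'r \<Rightarrow> 'r set" where
  "residue x = (\<lambda>i. i + x) ` I"

lemma a_r_coset_regular: "I +>\<^bsub>regular_module A\<^esub> x = residue x"
  by (auto simp: a_r_coset_def' regular_module_def subring_record_def residue_def)

lemma residue_self: "x \<in> residue x"
  using zero_I by (auto simp: residue_def intro: image_eqI[of _ _ 0])

lemma residue_eq_iff: "residue x = residue y \<longleftrightarrow> x - y \<in> I"
proof
  assume "residue x = residue y"
  then have "x \<in> residue y" using residue_self by blast
  then show "x - y \<in> I" by (auto simp: residue_def)
next
  assume xy: "x - y \<in> I"
  have "i + x \<in> residue y" if "i \<in> I" for i
    unfolding residue_def using add_I[OF that xy] by (intro image_eqI[of _ _ "i + (x - y)"]) simp_all
  moreover have "i + y \<in> residue x" if "i \<in> I" for i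
    unfolding residue_def using diff_I[OF that xy] by (intro image_eqI[of _ _ "i - (x - y)"]) simp_all
  ultimately show "residue x = residue y" by (auto simp: residue_def)
qed

lemma carrier_Q: "carrier Q = residue ` C"
  by (auto simp: quotient_module_def A_RCOSETS_def' a_r_coset_regular)
    (auto simp: regular_module_def subring_record_def)

lemma zero_Q: "\<zero>\<^bsub>Q\<^esub> = residue 0"
  by (simp add: quotient_module_def residue_def)

lemma add_Q: "residue x \<oplus>\<^bsub>Q\<^esub> residue y = residue (x + y)"
proof -
  have "residue x \<oplus>\<^bsub>Q\<^esub> residue y = {a + b | a b. a \<in> residue x \<and> b \<in> residue y}"
    by (auto simp: quotient_module_def set_add_def' regular_module_def subring_record_def)
  also have "\<dots> = residue (x + y)"
  proof (intro equalityI subsetI)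
    fix z assume "z \<in> {a + b | a b. a \<in> residue x \<and> b \<in> residue y}"
    then obtain i j where "i \<in> I" "j \<in> I" "z = (i + j) + (x + y)"
      by (auto simp: residue_def algebra_simps)
    then show "z \<in> residue (x + y)" unfolding residue_def using add_I by blast
  next
    fix z assume "z \<in> residue (x + y)"
    then obtain i where i: "i \<in> I" "z = (i + x) + y" by (auto simp: residue_def algebra_simps)
    then show "z \<in> {a + b | a b. a \<in> residue x \<and> b \<in> residue y}"
      using residue_self[of y] unfolding residue_def by blast
  qed
  finally show ?thesis .
qed

lemma smult_Q:
  assumes "r \<in> C"
  shows "r \<odot>\<^bsub>Q\<^esub> residue x = residue (r * x)"
proof -
  have "r \<odot>\<^bsub>Q\<^esub> residue x = (\<Union>y\<in>residue x. residue (r * y))"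
    by (simp add: quotient_module_def a_r_coset_regular)
      (simp add: regular_module_def subring_record_def)
  also have "\<dots> = residue (r * x)"
  proof -
    have "residue (r * y) = residue (r * x)" if "y \<in> residue x" for y
    proof -
      have "r * (y - x) \<in> I" using that assms mult_I by (auto simp: residue_def)
      then show ?thesis by (simp add: residue_eq_iff algebra_simps)
    qed
    then show ?thesis using residue_self by blast
  qed
  finally show ?thesis .
qed

definition fraction :: "'r \<Rightarrow> 'r \<Rightarrow> nat \<Rightarrow> ('r set \<times> nat) set" where
  "fraction f x n = frac A Q f (residue x) n"

abbreviation L where "L f \<equiv> localization A Q f"

lemma frac_rel_iff:
  assumes "f \<in> C" "x \<in> C" "y \<in> C"
  shows "((residue x, n), (residue y, m)) \<in> frac_rel A Q f \<longleftrightarrow> (\<exists>k. f ^ (k + m) * x - f ^ (k + n) * y \<in> I)"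
  using assms by (auto simp: frac_rel_def carrier_Q pow_A smult_Q power_C residue_eq_iff)

lemma frac_rel_mem:
  "p \<in> frac_rel A Q f \<Longrightarrow> \<exists>x\<in>C. \<exists>y\<in>C. \<exists>n m. p = ((residue x, n), (residue y, m))"
  by (auto simp: frac_rel_def carrier_Q)

lemma equiv_frac_rel:
  assumes f: "f \<in> C"
  shows "equiv (carrier Q \<times> UNIV) (frac_rel A Q f)"
proof (rule equivI)
  show "frac_rel A Q f \<subseteq> (carrier Q \<times> UNIV) \<times> carrier Q \<times> UNIV"
    by (auto simp: frac_rel_def)
  show "refl_on (carrier Q \<times> UNIV) (frac_rel A Q f)"
    by (auto simp: refl_on_def frac_rel_def)
  show "sym (frac_rel A Q f)"
    by (auto simp: sym_def frac_rel_def)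
  show "trans (frac_rel A Q f)"
  proof (rule transI)
    fix p q r assume pq: "(p, q) \<in> frac_rel A Q f" and qr: "(q, r) \<in> frac_rel A Q f"
    obtain x y n m where C: "x \<in> C" "y \<in> C" and p: "p = (residue x, n)" and q: "q = (residue y, m)"
      using frac_rel_mem[OF pq] by auto
    obtain z l where C': "z \<in> C" and r: "r = (residue z, l)"
      using frac_rel_mem[OF qr] by auto
    obtain k1 where 1: "f ^ (k1 + m) * x - f ^ (k1 + n) * y \<in> I"
      using pq C f unfolding p q by (auto simp: frac_rel_iff)
    obtain k2 where 2: "f ^ (k2 + l) * y - f ^ (k2 + m) * z \<in> I"
      using qr C C' f unfolding q r by (auto simp: frac_rel_iff)
    have "f ^ (k2 + l) * (f ^ (k1 + m) * x - f ^ (k1 + n) * y)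
      + f ^ (k1 + n) * (f ^ (k2 + l) * y - f ^ (k2 + m) * z) \<in> I"
      by (intro add_I mult_I power_C f 1 2)
    also have "f ^ (k2 + l) * (f ^ (k1 + m) * x - f ^ (k1 + n) * y)
      + f ^ (k1 + n) * (f ^ (k2 + l) * y - f ^ (k2 + m) * z)
      = f ^ ((k1 + k2 + m) + l) * x - f ^ ((k1 + k2 + m) + n) * z"
      by (simp add: algebra_simps power_add)
    finally show "(p, r) \<in> frac_rel A Q f"
      unfolding p r using frac_rel_iff[OF f C(1) C'] by blast
  qed
qed

text \<open>
  Clearing denominators: with the rules for numerators below, an identity of fractions becomes
  the membership of a ring element in \<open>I\<close>.
\<close>

lemma fraction_eq_iff:
  assumes "f \<in> C" "x \<in> C" "y \<in> C"
  shows "fraction f x n = fraction f y m \<longleftrightarrow> (\<exists>k. f ^ (k + m) * x - f ^ (k + n) * y \<in> I)"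
proof -
  have "fraction f x n = fraction f y m \<longleftrightarrow> ((residue x, n), (residue y, m)) \<in> frac_rel A Q f"
    unfolding fraction_def frac_def
    using assms by (intro eq_equiv_class_iff[OF equiv_frac_rel]) (auto simp: carrier_Q)
  then show ?thesis using assms by (simp add: frac_rel_iff)
qed

lemma fraction_mem:
  assumes "f \<in> C" "x \<in> C" "p \<in> fraction f x n"
  obtains y m where "y \<in> C" "p = (residue y, m)" "fraction f y m = fraction f x n"
proof -
  have *: "((residue x, n), p) \<in> frac_rel A Q f"
    using assms by (auto simp: fraction_def frac_def)
  then obtain y m where y: "y \<in> C" "p = (residue y, m)"
    using frac_rel_mem by blast
  moreover have "fraction f x n = fraction f y m"
    unfolding fraction_def frac_def using * unfolding y(2)
    by (rule equiv_class_eq[OF equiv_frac_rel[OF assms(1)]])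
  ultimately show thesis using that by simp
qed

lemma fraction_self: "f \<in> C \<Longrightarrow> x \<in> C \<Longrightarrow> (residue x, n) \<in> fraction f x n"
  unfolding fraction_def frac_def
  by (rule equiv_class_self[OF equiv_frac_rel]) (auto simp: carrier_Q)

lemma carrier_L:
  assumes "f \<in> C"
  shows "carrier (L f) = {fraction f x n | x n. x \<in> C}"
  by (auto simp: localization_def quotient_def carrier_Q fraction_def frac_def)

lemma fraction_carrier: "f \<in> C \<Longrightarrow> x \<in> C \<Longrightarrow> fraction f x n \<in> carrier (L f)"
  by (auto simp: carrier_L)

lemma zero_L: "\<zero>\<^bsub>L f\<^esub> = fraction f 0 0"
  by (simp add: localization_def fraction_def zero_Q)

lemma add_L:
  assumes f: "f \<in> C" and x: "x \<in> C" and y: "y \<in> C"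
  shows "fraction f x n \<oplus>\<^bsub>L f\<^esub> fraction f y m = fraction f (f ^ m * x + f ^ n * y) (n + m)"
proof -
  have "fraction f x n \<oplus>\<^bsub>L f\<^esub> fraction f y m =
    (\<Union>(X, a)\<in>fraction f x n. \<Union>(Y, b)\<in>fraction f y m.
        frac A Q f (((f [^]\<^bsub>A\<^esub> b) \<odot>\<^bsub>Q\<^esub> X) \<oplus>\<^bsub>Q\<^esub> ((f [^]\<^bsub>A\<^esub> a) \<odot>\<^bsub>Q\<^esub> Y)) (a + b))"
    by (simp add: localization_def)
  moreover have "frac A Q f (((f [^]\<^bsub>A\<^esub> b) \<odot>\<^bsub>Q\<^esub> X) \<oplus>\<^bsub>Q\<^esub> ((f [^]\<^bsub>A\<^esub> a) \<odot>\<^bsub>Q\<^esub> Y)) (a + b)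
     = fraction f (f ^ m * x + f ^ n * y) (n + m)"
    if X: "(X, a) \<in> fraction f x n" and Y: "(Y, b) \<in> fraction f y m" for X Y a b
  proof -
    obtain x' where x': "x' \<in> C" "X = residue x'" "fraction f x' a = fraction f x n"
      using fraction_mem[OF f x X] by auto
    obtain y' where y': "y' \<in> C" "Y = residue y'" "fraction f y' b = fraction f y m"
      using fraction_mem[OF f y Y] by auto
    obtain k where k: "f ^ (k + n) * x' - f ^ (k + a) * x \<in> I"
      using x'(3) by (auto simp: fraction_eq_iff f x x'(1))
    obtain l where l: "f ^ (l + m) * y' - f ^ (l + b) * y \<in> I"
      using y'(3) by (auto simp: fraction_eq_iff f y y'(1))
    have "f ^ (l + m + b) * (f ^ (k + n) * x' - f ^ (k + a) * x)
       + f ^ (k + n + a) * (f ^ (l + m) * y' - f ^ (l + b) * y) \<in> I"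
      by (intro add_I mult_I power_C f k l)
    also have "f ^ (l + m + b) * (f ^ (k + n) * x' - f ^ (k + a) * x)
       + f ^ (k + n + a) * (f ^ (l + m) * y' - f ^ (l + b) * y)
      = f ^ ((k + l) + (n + m)) * (f ^ b * x' + f ^ a * y')
        - f ^ ((k + l) + (a + b)) * (f ^ m * x + f ^ n * y)"
      by (simp add: algebra_simps power_add)
    finally have "fraction f (f ^ b * x' + f ^ a * y') (a + b) = fraction f (f ^ m * x + f ^ n * y) (n + m)"
      using f x y x' y' by (subst fraction_eq_iff) (auto intro: C_closed)
    then show ?thesis
      using f x' y' by (simp add: fraction_def pow_A smult_Q add_Q power_C)
  qed
  moreover have "fraction f x n \<noteq> {}" "fraction f y m \<noteq> {}" using fraction_self f x y by blast+
  ultimately show ?thesis by fastforce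
qed

lemma further_localize_fraction:
  assumes f: "f \<in> C" and g: "g \<in> C" and x: "x \<in> C" 
  shows "further_localize A Q g (f * g) (fraction f x n) = fraction (f * g) (g ^ n * x) n"
proof -
  have "further_localize A Q g (f * g) (fraction f x n) =
     (\<Union>(X, a)\<in>fraction f x n. frac A Q (f * g) ((g [^]\<^bsub>A\<^esub> a) \<odot>\<^bsub>Q\<^esub> X) a)"
    by (simp add: further_localize_def)
  moreover have "frac A Q (f * g) ((g [^]\<^bsub>A\<^esub> a) \<odot>\<^bsub>Q\<^esub> X) a = fraction (f * g) (g ^ n * x) n"
    if X: "(X, a) \<in> fraction f x n" for X a
  proof -
    obtain x' where x': "x' \<in> C" "X = residue x'" "fraction f x' a = fraction f x n"
      using fraction_mem[OF f x X] by auto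
    obtain k where k: "f ^ (k + n) * x' - f ^ (k + a) * x \<in> I"
      using x'(3) by (auto simp: fraction_eq_iff f x x'(1))
    have "g ^ (k + n + a) * (f ^ (k + n) * x' - f ^ (k + a) * x) \<in> I"
      by (intro mult_I power_C g k)
    also have "g ^ (k + n + a) * (f ^ (k + n) * x' - f ^ (k + a) * x)
      = (f * g) ^ (k + n) * (g ^ a * x') - (f * g) ^ (k + a) * (g ^ n * x)"
      by (simp add: algebra_simps power_add power_mult_distrib)
    finally have "fraction (f * g) (g ^ a * x') a = fraction (f * g) (g ^ n * x) n"
      using f g x x' by (subst fraction_eq_iff) (auto intro: C_closed)
    then show ?thesis
      using g x' by (simp add: fraction_def pow_A smult_Q power_C)
  qed
  moreover have "fraction f x n \<noteq> {}" using fraction_self f x by blast+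
  ultimately show ?thesis by fastforce
qed

lemma fraction_scale:
  assumes "f \<in> C" "x \<in> C"
  shows "fraction f (f ^ k * x) (n + k) = fraction f x n"
proof -
  have "f ^ (0 + n) * (f ^ k * x) - f ^ (0 + (n + k)) * x = 0"
    by (simp add: algebra_simps power_add)
  then show ?thesis
    using assms zero_I by (subst fraction_eq_iff) (auto intro: C_closed exI[of _ 0])
qed

lemma fraction_add_same:
  assumes "f \<in> C" "x \<in> C" "y \<in> C"
  shows "fraction f x n \<oplus>\<^bsub>L f\<^esub> fraction f y n = fraction f (x + y) n"
proof -
  have "fraction f x n \<oplus>\<^bsub>L f\<^esub> fraction f y n = fraction f (f ^ n * (x + y)) (n + n)"
    using assms by (simp add: add_L algebra_simps)
  then show ?thesis using assms by (simp add: fraction_scale add_C)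
qed

lemma fraction_zero: "f \<in> C \<Longrightarrow> fraction f 0 n = \<zero>\<^bsub>L f\<^esub>"
  using fraction_scale[of f 0 n 0] by (simp add: zero_L zero_C)

lemma abelian_group_L:
  assumes f: "f \<in> C"
  shows "abelian_group (L f)"
proof (rule abelian_groupI)
  show "\<zero>\<^bsub>L f\<^esub> \<in> carrier (L f)" by (simp add: zero_L f fraction_carrier zero_C)
  fix X assume "X \<in> carrier (L f)"
  then obtain x n where X: "x \<in> C" "X = fraction f x n" by (auto simp: carrier_L f)
  show "\<zero>\<^bsub>L f\<^esub> \<oplus>\<^bsub>L f\<^esub> X = X"
    using X f fraction_add_same[of f 0 x n] by (simp add: fraction_zero zero_C)
  show "\<exists>Y\<in>carrier (L f). Y \<oplus>\<^bsub>L f\<^esub> X = \<zero>\<^bsub>L f\<^esub>"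
    using X f by (intro bexI[of _ "fraction f (- x) n"]) (simp_all add: fraction_add_same fraction_zero C_closed fraction_carrier)
  fix Y assume "Y \<in> carrier (L f)"
  then obtain y m where Y: "y \<in> C" "Y = fraction f y m" by (auto simp: carrier_L f)
  show "X \<oplus>\<^bsub>L f\<^esub> Y \<in> carrier (L f)"
    using X Y f by (simp add: add_L fraction_carrier C_closed)
  show "X \<oplus>\<^bsub>L f\<^esub> Y = Y \<oplus>\<^bsub>L f\<^esub> X"
    using X Y f by (simp add: add_L C_closed algebra_simps)
  fix Z assume "Z \<in> carrier (L f)"
  then obtain z l where Z: "z \<in> C" "Z = fraction f z l" by (auto simp: carrier_L f)
  show "X \<oplus>\<^bsub>L f\<^esub> Y \<oplus>\<^bsub>L f\<^esub> Z = X \<oplus>\<^bsub>L f\<^esub> (Y \<oplus>\<^bsub>L f\<^esub> Z)"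
    using X Y Z f by (simp add: add_L C_closed algebra_simps power_add)
qed

lemma minus_L:
  assumes "f \<in> C" "x \<in> C"
  shows "\<ominus>\<^bsub>L f\<^esub> fraction f x n = fraction f (- x) n"
proof -
  interpret abelian_group "L f" by (rule abelian_group_L[OF assms(1)])
  show ?thesis
    using assms by (intro minus_equality) (simp_all add: fraction_add_same fraction_zero C_closed fraction_carrier)
qed

lemma signed_L:
  assumes "f \<in> C" "x \<in> C"
  shows "signed (L f) k (fraction f x n) = fraction f ((- 1) ^ k * x) n"
  using assms by (cases "even k") (simp_all add: signed_def minus_L)

text \<open>
  Over a common denominator, the sum in the definition of the Cech differential becomes an ordinary
  sum of ring elements.
\<close>

lemma finsum_L:
  assumes "f \<in> C" "finite T" "\<And>j. j \<in> T \<Longrightarrow> x j \<in> C"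
  shows "(\<Oplus>\<^bsub>L f\<^esub>j\<in>T. fraction f (x j) n) = fraction f (\<Sum>j\<in>T. x j) n"
proof -
  interpret abelian_group "L f" by (rule abelian_group_L[OF assms(1)])
  show ?thesis using assms(2,3)
  proof (induction T)
    case empty
    then show ?case using assms(1) by (simp add: fraction_zero)
  next
    case (insert j T)
    have "(\<Oplus>\<^bsub>L f\<^esub>j\<in>insert j T. fraction f (x j) n) = fraction f (x j) n \<oplus>\<^bsub>L f\<^esub> (\<Oplus>\<^bsub>L f\<^esub>j\<in>T. fraction f (x j) n)"
      using insert assms(1) by (intro finsum_insert) (auto intro: fraction_carrier)
    then show ?case using insert assms(1) by (simp add: fraction_add_same sum_C)
  qed
qed

end

section \<open>Cech cohomology through numerators\<close>

text \<open>
  In the following, \<open>pos\<close> is the position of an index in an ordering, and a family of numerators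
  \<open>g \<sigma>\<close> with a common exponent \<open>n\<close> stands for the Cech cochain of the fractions \<open>g \<sigma> / x\<^sub>\<sigma>\<^sup>n\<close>, where
  \<open>x\<^sub>\<sigma>\<close> is the product of the \<open>x v\<close> for \<open>v \<in> \<sigma>\<close>. Then \<open>num_diff\<close> gives the numerators of its
  differential, with the same exponent, and \<open>is_cocycle\<close> and \<open>is_coboundary\<close> express, after clearing
  denominators, that the cochain with values in the localizations of \<open>C/I\<close> is a cocycle or a
  coboundary.
  In degree \<open>0\<close> the sum \<open>num_diff\<close> is empty, so that the only coboundary is zero.
\<close>

definition order_sign :: "('i \<Rightarrow> nat) \<Rightarrow> 'i set \<Rightarrow> 'i \<Rightarrow> 'r::comm_ring_1" where
  "order_sign pos \<tau> v = (- 1) ^ card {u \<in> \<tau>. pos u < pos v}"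

definition num_diff ::
  "('i \<Rightarrow> 'r::comm_ring_1) \<Rightarrow> ('i \<Rightarrow> nat) \<Rightarrow> nat \<Rightarrow> ('i set \<Rightarrow> 'r) \<Rightarrow> 'i set \<Rightarrow> 'r" where
  "num_diff x pos n g \<tau> = (\<Sum>v\<in>\<tau>. order_sign pos \<tau> v * (x v ^ n * g (\<tau> - {v})))"

lemma num_diff_add: "num_diff x pos n (\<lambda>\<sigma>. g \<sigma> + h \<sigma>) \<tau> = num_diff x pos n g \<tau> + num_diff x pos n h \<tau>"
  by (simp add: num_diff_def algebra_simps sum.distrib)

lemma num_diff_uminus: "num_diff x pos n (\<lambda>\<sigma>. - h \<sigma>) \<tau> = - num_diff x pos n h \<tau>"
  by (simp add: num_diff_def sum_negf)

definition is_cocycle ::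
  "'r::comm_ring_1 set \<Rightarrow> 'r set \<Rightarrow> 'i set \<Rightarrow> ('i \<Rightarrow> 'r) \<Rightarrow> ('i \<Rightarrow> nat) \<Rightarrow> nat \<Rightarrow>
    nat \<Rightarrow> ('i set \<Rightarrow> 'r) \<Rightarrow> bool" where
  "is_cocycle C I V x pos p n g \<longleftrightarrow> (\<forall>\<sigma>. g \<sigma> \<in> C) \<and>
     (\<forall>\<tau>. \<tau> \<subseteq> V \<and> card \<tau> = Suc p \<longrightarrow> (\<exists>k. prod x \<tau> ^ k * num_diff x pos n g \<tau> \<in> I))"

definition is_coboundary ::
  "'r::comm_ring_1 set \<Rightarrow> 'r set \<Rightarrow> 'i set \<Rightarrow> ('i \<Rightarrow> 'r) \<Rightarrow> ('i \<Rightarrow> nat) \<Rightarrow> nat \<Rightarrow>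
    nat \<Rightarrow> ('i set \<Rightarrow> 'r) \<Rightarrow> bool" where
  "is_coboundary C I V x pos p n g \<longleftrightarrow> (\<exists>m h. (\<forall>\<sigma>. h \<sigma> \<in> C) \<and>
     (\<forall>\<sigma>. \<sigma> \<subseteq> V \<and> card \<sigma> = p \<longrightarrow>
        (\<exists>k. prod x \<sigma> ^ k * (prod x \<sigma> ^ m * g \<sigma> - prod x \<sigma> ^ n * num_diff x pos m h \<sigma>) \<in> I)))"

definition has_class ::
  "'r::comm_ring_1 set \<Rightarrow> 'r set \<Rightarrow> 'i set \<Rightarrow> ('i \<Rightarrow> 'r) \<Rightarrow> ('i \<Rightarrow> nat) \<Rightarrow> nat \<Rightarrow> bool" where
  "has_class C I V x pos p \<longleftrightarrow>
     (\<exists>n g. is_cocycle C I V x pos p n g \<and> \<not> is_coboundary C I V x pos p n g)"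

text \<open>
  The abbreviations \<open>X\<close>, \<open>d\<close> and \<open>CM\<close> denote the denominators, the differential on numerators and the
  modules of the Cech complex of \<open>C/I\<close>; \<open>cochain n g p\<close> is the \<open>p\<close>-cochain of the fractions
  \<open>g \<sigma> / X \<sigma>\<^sup>n\<close>.
\<close>

locale cech_of_quotient = quotient_of_subring C I for C I :: "'r::comm_ring_1 set" +
  fixes fs :: "'r list"
  assumes fs_C: "set fs \<subseteq> C"
begin

abbreviation X where "X \<equiv> prod ((!) fs)"
abbreviation d where "d \<equiv> num_diff ((!) fs) (\<lambda>i. i)"
abbreviation idx where "idx \<equiv> cech_index (length fs)"
abbreviation CM where "CM \<equiv> cech_module A fs Q"

definition cochain :: "nat \<Rightarrow> (nat set \<Rightarrow> 'r) \<Rightarrow> nat \<Rightarrow> nat set \<Rightarrow> ('r set \<times> nat) set" where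
  "cochain n g p = (\<lambda>\<sigma>\<in>idx p. fraction (X \<sigma>) (g \<sigma>) n)"

lemma finite_idx: "finite (idx p)"
  by (simp add: cech_index_def)

lemma idxD: "\<sigma> \<in> idx p \<Longrightarrow> finite \<sigma> \<and> \<sigma> \<subseteq> {..<length fs} \<and> card \<sigma> = p"
  by (auto simp: cech_index_def intro: finite_subset)

lemma nth_C: "i < length fs \<Longrightarrow> fs ! i \<in> C"
  using fs_C by auto

lemma X_C: "\<sigma> \<in> idx p \<Longrightarrow> X \<sigma> \<in> C"
  by (auto dest!: idxD intro!: prod_C nth_C)

lemma cech_elem_eq:
  assumes "\<sigma> \<in> idx p"
  shows "cech_elem A fs \<sigma> = X \<sigma>"
proof -
  interpret cring A by (rule cring_A)
  have "finite \<sigma>" "\<sigma> \<subseteq> {..<length fs}" using idxD[OF assms] by auto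
  then have "(\<Otimes>\<^bsub>A\<^esub>i\<in>\<sigma>. fs ! i) = X \<sigma>"
  proof (induction \<sigma>)
    case empty
    have "\<one>\<^bsub>A\<^esub> = 1" by (simp add: subring_record_def)
    then show ?case by simp
  next
    case (insert i \<sigma>)
    have "(\<lambda>i. fs ! i) \<in> \<sigma> \<rightarrow> carrier A" "fs ! i \<in> carrier A"
      using insert.prems nth_C by (auto simp: subring_record_def)
    then have "(\<Otimes>\<^bsub>A\<^esub>i\<in>insert i \<sigma>. fs ! i) = fs ! i \<otimes>\<^bsub>A\<^esub> (\<Otimes>\<^bsub>A\<^esub>i\<in>\<sigma>. fs ! i)"
      using insert.hyps by (intro finprod_insert)
    then show ?case using insert by (simp add: subring_record_def)
  qed
  then show ?thesis by (simp add: cech_elem_def)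
qed

lemma idx_Suc_remove: "\<sigma> \<in> idx (Suc p) \<Longrightarrow> j \<in> \<sigma> \<Longrightarrow> \<sigma> - {j} \<in> idx p"
  by (auto simp: cech_index_def)

lemma X_remove: "\<sigma> \<in> idx p \<Longrightarrow> j \<in> \<sigma> \<Longrightarrow> X \<sigma> = X (\<sigma> - {j}) * fs ! j"
  using idxD[of \<sigma> p] by (simp add: prod.remove[of \<sigma> j] mult.commute)

lemma num_diff_C:
  assumes "\<And>\<rho>. g \<rho> \<in> C" "\<sigma> \<in> idx p"
  shows "d n g \<sigma> \<in> C"
  unfolding num_diff_def order_sign_def using assms idxD[OF assms(2)]
  by (intro sum_C mult_C power_C minus_C one_C) (auto intro: nth_C)

lemma carrier_CM: "carrier (CM p) = (\<Pi>\<^sub>E \<sigma>\<in>idx p. carrier (L (X \<sigma>)))"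
  by (auto simp: cech_module_def cech_elem_eq intro!: PiE_cong)

lemma cochain_carrier: "(\<And>\<sigma>. g \<sigma> \<in> C) \<Longrightarrow> cochain n g p \<in> carrier (CM p)"
  unfolding carrier_CM cochain_def by (auto intro!: fraction_carrier X_C)

text \<open>
  A cochain has finitely many entries, so that all of them can be written with the same exponent.
\<close>

lemma cochain_cases:
  assumes "c \<in> carrier (CM p)"
  shows "\<exists>n g. (\<forall>\<sigma>. g \<sigma> \<in> C) \<and> c = cochain n g p"
proof -
  have "\<exists>n y. y \<in> C \<and> c \<sigma> = fraction (X \<sigma>) y n" if "\<sigma> \<in> idx p" for \<sigma>
    using PiE_mem[OF assms[unfolded carrier_CM] that] carrier_L[OF X_C[OF that]] by auto
  then obtain n y where ny: "\<And>\<sigma>. \<sigma> \<in> idx p \<Longrightarrow> y \<sigma> \<in> C \<and> c \<sigma> = fraction (X \<sigma>) (y \<sigma>) (n \<sigma>)"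
    by metis
  define N where "N = (\<Sum>\<sigma>\<in>idx p. n \<sigma>)"
  define g where "g \<sigma> = (if \<sigma> \<in> idx p then X \<sigma> ^ (N - n \<sigma>) * y \<sigma> else 0)" for \<sigma>
  have "g \<sigma> \<in> C" for \<sigma>
    using ny by (auto simp: g_def intro!: C_closed X_C)
  moreover have "c = cochain N g p"
  proof
    fix \<sigma>
    show "c \<sigma> = cochain N g p \<sigma>"
    proof (cases "\<sigma> \<in> idx p")
      case True
      then have "n \<sigma> \<le> N" unfolding N_def using finite_idx by (intro member_le_sum) auto
      then have "fraction (X \<sigma>) (g \<sigma>) N = fraction (X \<sigma>) (y \<sigma>) (n \<sigma>)"
        using fraction_scale[OF X_C[OF True], of "y \<sigma>" "N - n \<sigma>" "n \<sigma>"] ny[OF True] True by (simp add: g_def)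
      then show ?thesis using True ny[OF True] by (simp add: cochain_def)
    next
      case False
      then show ?thesis using assms by (auto simp: cochain_def carrier_CM PiE_def extensional_def)
    qed
  qed
  ultimately show ?thesis by blast
qed

lemma cochain_eq_iff:
  assumes "\<And>\<sigma>. \<sigma> \<in> idx p \<Longrightarrow> g \<sigma> \<in> C" "\<And>\<sigma>. \<sigma> \<in> idx p \<Longrightarrow> h \<sigma> \<in> C"
  shows "cochain n g p = cochain m h p \<longleftrightarrow>
    (\<forall>\<sigma>\<in>idx p. \<exists>k. X \<sigma> ^ k * (X \<sigma> ^ m * g \<sigma> - X \<sigma> ^ n * h \<sigma>) \<in> I)"
proof -
  have "cochain n g p = cochain m h p \<longleftrightarrow> (\<forall>\<sigma>\<in>idx p. fraction (X \<sigma>) (g \<sigma>) n = fraction (X \<sigma>) (h \<sigma>) m)"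
    by (auto simp: cochain_def fun_eq_iff)
  also have "\<dots> \<longleftrightarrow> (\<forall>\<sigma>\<in>idx p. \<exists>k. X \<sigma> ^ k * (X \<sigma> ^ m * g \<sigma> - X \<sigma> ^ n * h \<sigma>) \<in> I)"
    using assms by (intro ball_cong refl) (simp add: fraction_eq_iff X_C algebra_simps power_add)
  finally show ?thesis .
qed

lemma zero_CM: "\<zero>\<^bsub>CM p\<^esub> = cochain n (\<lambda>_. 0) p"
  unfolding cochain_def by (simp add: cech_module_def) (rule restrict_ext, simp add: cech_elem_eq fraction_zero X_C)

lemma add_CM:
  assumes "\<And>\<sigma>. \<sigma> \<in> idx p \<Longrightarrow> g \<sigma> \<in> C" "\<And>\<sigma>. \<sigma> \<in> idx p \<Longrightarrow> h \<sigma> \<in> C"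
  shows "cochain n g p \<oplus>\<^bsub>CM p\<^esub> cochain n h p = cochain n (\<lambda>\<sigma>. g \<sigma> + h \<sigma>) p"
  using assms unfolding cochain_def
  by (simp add: cech_module_def) (rule restrict_ext, simp add: cech_elem_eq fraction_add_same X_C)

lemma cech_diff_cochain:
  assumes "\<And>\<sigma>. g \<sigma> \<in> C"
  shows "cech_diff A fs Q p (cochain n g p) = cochain n (d n g) (Suc p)"
proof
  fix \<sigma>
  show "cech_diff A fs Q p (cochain n g p) \<sigma> = cochain n (d n g) (Suc p) \<sigma>"
  proof (cases "\<sigma> \<in> idx (Suc p)")
    case True
    have fin: "finite \<sigma>" and sub: "\<sigma> \<subseteq> {..<length fs}" using idxD[OF True] by auto
    have "signed (L (X \<sigma>)) (card {i \<in> \<sigma>. i < j})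
            (further_localize A Q (fs ! j) (X \<sigma>) (cochain n g p (\<sigma> - {j})))
        = fraction (X \<sigma>) (order_sign (\<lambda>i. i) \<sigma> j * (fs ! j ^ n * g (\<sigma> - {j}))) n"
      if j: "j \<in> \<sigma>" for j
    proof -
      have fj: "fs ! j \<in> C" using sub j by (auto intro: nth_C)
      have "further_localize A Q (fs ! j) (X \<sigma>) (cochain n g p (\<sigma> - {j}))
         = fraction (X \<sigma>) (fs ! j ^ n * g (\<sigma> - {j})) n"
        using further_localize_fraction[OF X_C[OF idx_Suc_remove[OF True j]] fj assms]
        by (simp add: cochain_def idx_Suc_remove[OF True j] X_remove[OF True j])
      then show ?thesis
        using fj assms True by (simp add: signed_L X_C C_closed order_sign_def)
    qed
    then have "cech_diff A fs Q p (cochain n g p) \<sigma> =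
        (\<Oplus>\<^bsub>L (X \<sigma>)\<^esub>j\<in>\<sigma>. fraction (X \<sigma>) (order_sign (\<lambda>i. i) \<sigma> j * (fs ! j ^ n * g (\<sigma> - {j}))) n)"
      using True X_C[OF True] sub nth_C assms
      by (simp add: cech_diff_def cech_elem_eq[OF True] order_sign_def cong: if_cong)
         (rule abelian_monoid.finsum_cong'[OF abelian_group.axioms(1)[OF abelian_group_L]],
           auto intro!: fraction_carrier C_closed)
    also have "\<dots> = fraction (X \<sigma>) (d n g \<sigma>) n"
      unfolding num_diff_def using X_C[OF True] sub assms fin
      by (intro finsum_L) (auto simp: order_sign_def intro!: C_closed nth_C)
    finally show ?thesis using True by (simp add: cochain_def)
  next
    case False
    then show ?thesis by (simp add: cech_diff_def cochain_def)
  qed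
qed

lemma cochain_in_cocycles:
  assumes "\<And>\<sigma>. g \<sigma> \<in> C"
  shows "cochain n g p \<in> cech_cocycles A fs Q p \<longleftrightarrow>
    (\<forall>\<tau>\<in>idx (Suc p). \<exists>k. X \<tau> ^ k * d n g \<tau> \<in> I)"
proof -
  have "cochain n g p \<in> cech_cocycles A fs Q p \<longleftrightarrow> cochain n (d n g) (Suc p) = cochain 0 (\<lambda>_. 0) (Suc p)"
    using assms by (simp add: cech_cocycles_def a_kernel_def' cech_diff_cochain cochain_carrier
        zero_CM[of _ 0])
  then show ?thesis
    using assms by (simp add: cochain_eq_iff num_diff_C zero_C)
qed

text \<open>
  This covers degree \<open>0\<close> as well, where the differential on numerators is an empty sum.
\<close>

lemma cech_coboundaries_eq:
  "cech_coboundaries A fs Q p = {cochain m (d m h) p | m h. \<forall>\<sigma>. h \<sigma> \<in> C}"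
proof (cases p)
  case 0
  have "d m h \<sigma> = 0" if "\<sigma> \<in> idx 0" for m h \<sigma>
    using idxD[OF that] by (auto simp: num_diff_def)
  then have "cochain m (d m h) 0 = cochain m (\<lambda>_. 0) 0" for m h
    unfolding cochain_def by (intro restrict_ext) simp
  then show ?thesis
    using zero_C by (auto simp: 0 zero_CM[symmetric])
next
  case (Suc q)
  have "cech_diff A fs Q q ` carrier (CM q) = {cochain m (d m h) (Suc q) | m h. \<forall>\<sigma>. h \<sigma> \<in> C}"
  proof (intro equalityI subsetI)
    fix c assume "c \<in> cech_diff A fs Q q ` carrier (CM q)"
    then obtain b where "b \<in> carrier (CM q)" and c: "c = cech_diff A fs Q q b" by blast
    then obtain m h where h: "\<forall>\<sigma>. h \<sigma> \<in> C" and b: "b = cochain m h q"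
      using cochain_cases by blast
    show "c \<in> {cochain m (d m h) (Suc q) | m h. \<forall>\<sigma>. h \<sigma> \<in> C}"
      unfolding c b using h by (auto simp: cech_diff_cochain)
  next
    fix c assume "c \<in> {cochain m (d m h) (Suc q) | m h. \<forall>\<sigma>. h \<sigma> \<in> C}"
    then obtain m h where h: "\<And>\<sigma>. h \<sigma> \<in> C" "c = cochain m (d m h) (Suc q)" by auto
    then show "c \<in> cech_diff A fs Q q ` carrier (CM q)"
      by (intro image_eqI[of _ _ "cochain m h q"]) (simp_all add: cech_diff_cochain cochain_carrier)
  qed
  then show ?thesis by (simp add: Suc)
qed

text \<open>
  Two coboundaries are brought to the same exponent, in order to add them.
\<close>

lemma rescale_coboundary:
  assumes "\<And>\<sigma>. h \<sigma> \<in> C"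
  shows "\<exists>h'. (\<forall>\<sigma>. h' \<sigma> \<in> C) \<and> cochain m (d m h) p = cochain (m + l) (d (m + l) h') p"
proof -
  define h' where "h' \<sigma> = (if \<sigma> \<subseteq> {..<length fs} then X \<sigma> ^ l * h \<sigma> else 0)" for \<sigma>
  have h': "h' \<sigma> \<in> C" for \<sigma>
    using assms by (auto simp: h'_def intro!: C_closed prod_C nth_C)
  have "d (m + l) h' \<sigma> = X \<sigma> ^ l * d m h \<sigma>" if \<sigma>: "\<sigma> \<in> idx p" for \<sigma>
    unfolding num_diff_def sum_distrib_left
  proof (rule sum.cong[OF refl])
    fix v assume v: "v \<in> \<sigma>"
    have "\<sigma> - {v} \<subseteq> {..<length fs}" using idxD[OF \<sigma>] by auto
    then show "order_sign (\<lambda>i. i) \<sigma> v * (fs ! v ^ (m + l) * h' (\<sigma> - {v})) =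
      X \<sigma> ^ l * (order_sign (\<lambda>i. i) \<sigma> v * (fs ! v ^ m * h (\<sigma> - {v})))"
      by (simp add: h'_def X_remove[OF \<sigma> v] algebra_simps power_add power_mult_distrib)
  qed
  then have "cochain m (d m h) p = cochain (m + l) (d (m + l) h') p"
    using assms unfolding cochain_def by (intro restrict_ext) (simp add: fraction_scale X_C num_diff_C)
  then show ?thesis using h' by blast
qed

text \<open>
  The cosets of the coboundaries \<open>B\<close> form the cohomology. For a cocycle in \<open>B\<close> the coset is \<open>B\<close>
  itself because \<open>B\<close> is closed under sums and differences.
\<close>

lemma cohomology_nontrivial_iff:
  "carrier (local_cohomology A fs p Q) \<noteq> {\<zero>\<^bsub>local_cohomology A fs p Q\<^esub>} \<longleftrightarrow>
    \<not> cech_cocycles A fs Q p \<subseteq> cech_coboundaries A fs Q p"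
proof -
  define Z where "Z = cech_cocycles A fs Q p"
  define B where "B = cech_coboundaries A fs Q p"
  define shift where "shift z = (\<lambda>b. b \<oplus>\<^bsub>CM p\<^esub> z) ` B" for z
  have car: "carrier (local_cohomology A fs p Q) = shift ` Z"
    by (auto simp: local_cohomology_def quotient_module_def A_RCOSETS_def' a_r_coset_def' Z_def
        B_def shift_def)
  have zero: "\<zero>\<^bsub>local_cohomology A fs p Q\<^esub> = B"
    by (simp add: local_cohomology_def quotient_module_def B_def)
  have zeroZ: "cochain 0 (\<lambda>_. 0) p \<in> Z"
    unfolding Z_def using zero_C zero_I by (simp add: cochain_in_cocycles num_diff_def)
  have zeroB: "cochain n (\<lambda>_. 0) p \<in> B" for n
  proof -
    have "cochain n (\<lambda>_. 0) p = cochain n (d n (\<lambda>_. 0)) p"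
      by (simp add: num_diff_def[abs_def])
    then show ?thesis unfolding B_def cech_coboundaries_eq using zero_C by blast
  qed
  have "z \<in> shift z" if "z \<in> Z" for z
  proof -
    have "z \<in> carrier (CM p)" using that by (simp add: Z_def cech_cocycles_def a_kernel_def')
    then obtain n g where g: "\<forall>\<sigma>. g \<sigma> \<in> C" "z = cochain n g p"
      using cochain_cases by blast
    then have "cochain n (\<lambda>_. 0) p \<oplus>\<^bsub>CM p\<^esub> z = z" by (simp add: add_CM zero_C)
    then show ?thesis unfolding shift_def using zeroB[of n] by force
  qed
  moreover have "shift z = B" if z: "z \<in> B" for z
  proof -
    have comb: "\<exists>N h h'. (\<forall>\<sigma>. h \<sigma> \<in> C) \<and> (\<forall>\<sigma>. h' \<sigma> \<in> C) \<and>
        b = cochain N (d N h) p \<and> z = cochain N (d N h') p" if "b \<in> B" for b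
    proof -
      obtain m h where h: "\<And>\<sigma>. h \<sigma> \<in> C" "b = cochain m (d m h) p"
        using \<open>b \<in> B\<close> by (auto simp: B_def cech_coboundaries_eq)
      obtain l h' where h': "\<And>\<sigma>. h' \<sigma> \<in> C" "z = cochain l (d l h') p"
        using z by (auto simp: B_def cech_coboundaries_eq)
      show ?thesis
        using rescale_coboundary[of h m p l, OF h(1)] rescale_coboundary[of h' l p m, OF h'(1)] h(2) h'(2)
        by (metis add.commute)
    qed
    have "b \<oplus>\<^bsub>CM p\<^esub> z \<in> B" if b: "b \<in> B" for b
    proof -
      obtain N h h' where h: "\<And>\<sigma>. h \<sigma> \<in> C" "\<And>\<sigma>. h' \<sigma> \<in> C"
        "b = cochain N (d N h) p" "z = cochain N (d N h') p"
        using comb[OF b] by blast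
      then have "b \<oplus>\<^bsub>CM p\<^esub> z = cochain N (d N (\<lambda>\<sigma>. h \<sigma> + h' \<sigma>)) p"
        by (simp add: add_CM num_diff_C num_diff_add[abs_def])
      then show ?thesis unfolding B_def cech_coboundaries_eq using h add_C by blast
    qed
    moreover have "b \<in> shift z" if b: "b \<in> B" for b
    proof -
      obtain N h h' where h: "\<And>\<sigma>. h \<sigma> \<in> C" "\<And>\<sigma>. h' \<sigma> \<in> C"
        "b = cochain N (d N h) p" "z = cochain N (d N h') p"
        using comb[OF b] by blast
      let ?h = "\<lambda>\<sigma>. h \<sigma> + - h' \<sigma>"
      have "cochain N (d N ?h) p \<in> B"
        unfolding B_def cech_coboundaries_eq using h add_C minus_C by blast
      moreover have "cochain N (d N ?h) p \<oplus>\<^bsub>CM p\<^esub> z = b"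
        unfolding h(3,4) using h(1,2)
        by (subst add_CM) (auto simp: num_diff_C num_diff_add num_diff_uminus C_closed simp del: add_uminus_conv_diff)
      ultimately show ?thesis unfolding shift_def by force
    qed
    ultimately show ?thesis by (auto simp: shift_def)
  qed
  ultimately have "shift ` Z = {B} \<longleftrightarrow> Z \<subseteq> B"
    using zeroZ by blast
  then show ?thesis by (simp add: car zero Z_def B_def)
qed

lemma cohomology_nontrivial_iff_has_class:
  "carrier (local_cohomology A fs p Q) \<noteq> {\<zero>\<^bsub>local_cohomology A fs p Q\<^esub>} \<longleftrightarrow>
    has_class C I {..<length fs} ((!) fs) (\<lambda>i. i) p"
proof -
  have cob: "cochain n g p \<in> cech_coboundaries A fs Q p \<longleftrightarrow>
    (\<exists>m h. (\<forall>\<sigma>. h \<sigma> \<in> C) \<and>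
       (\<forall>\<sigma>\<in>idx p. \<exists>k. X \<sigma> ^ k * (X \<sigma> ^ m * g \<sigma> - X \<sigma> ^ n * d m h \<sigma>) \<in> I))"
    if "\<And>\<sigma>. g \<sigma> \<in> C" for n g
  proof -
    have "cochain n g p \<in> cech_coboundaries A fs Q p \<longleftrightarrow>
      (\<exists>m h. (\<forall>\<sigma>. h \<sigma> \<in> C) \<and> cochain n g p = cochain m (d m h) p)"
      unfolding cech_coboundaries_eq by blast
    also have "\<dots> \<longleftrightarrow> (\<exists>m h. (\<forall>\<sigma>. h \<sigma> \<in> C) \<and>
       (\<forall>\<sigma>\<in>idx p. \<exists>k. X \<sigma> ^ k * (X \<sigma> ^ m * g \<sigma> - X \<sigma> ^ n * d m h \<sigma>) \<in> I))"
      by (intro ex_cong1 conj_cong refl cochain_eq_iff) (auto simp: that num_diff_C)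
    finally show ?thesis .
  qed
  have "\<not> cech_cocycles A fs Q p \<subseteq> cech_coboundaries A fs Q p \<longleftrightarrow>
    (\<exists>n g. (\<forall>\<sigma>. g \<sigma> \<in> C) \<and> cochain n g p \<in> cech_cocycles A fs Q p \<and>
       cochain n g p \<notin> cech_coboundaries A fs Q p)"
  proof
    assume "\<not> cech_cocycles A fs Q p \<subseteq> cech_coboundaries A fs Q p"
    then obtain c where c: "c \<in> cech_cocycles A fs Q p" "c \<notin> cech_coboundaries A fs Q p" by blast
    have "c \<in> carrier (CM p)" using c by (simp add: cech_cocycles_def a_kernel_def')
    then obtain n g where "\<forall>\<sigma>. g \<sigma> \<in> C" "c = cochain n g p"
      using cochain_cases by blast
    then show "\<exists>n g. (\<forall>\<sigma>. g \<sigma> \<in> C) \<and> cochain n g p \<in> cech_cocycles A fs Q p \<and>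
       cochain n g p \<notin> cech_coboundaries A fs Q p" using c by blast
  qed blast
  also have "\<dots> \<longleftrightarrow> has_class C I {..<length fs} ((!) fs) (\<lambda>i. i) p"
    unfolding has_class_def is_cocycle_def is_coboundary_def conj_assoc
    by (intro ex_cong1 conj_cong refl arg_cong[where f = Not])
      (auto simp: cochain_in_cocycles cob cech_index_def)
  finally show ?thesis by (simp add: cohomology_nontrivial_iff)
qed

end

lemma num_diff_reindex:
  assumes "inj_on \<phi> \<tau>" "\<And>i. i \<in> \<tau> \<Longrightarrow> x' i = x (\<phi> i)" "\<And>i. i \<in> \<tau> \<Longrightarrow> pos' i = pos (\<phi> i)"
    and g: "\<And>i. i \<in> \<tau> \<Longrightarrow> g' (\<tau> - {i}) = g (\<phi> ` (\<tau> - {i}))"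
  shows "num_diff x' pos' n g' \<tau> = num_diff x pos n g (\<phi> ` \<tau>)"
  unfolding num_diff_def sum.reindex[OF assms(1)] o_def
proof (rule sum.cong[OF refl])
  fix i assume i: "i \<in> \<tau>"
  have "{u \<in> \<phi> ` \<tau>. pos u < pos (\<phi> i)} = \<phi> ` {u \<in> \<tau>. pos' u < pos' i}"
    using assms(3) i by auto
  then have "card {u \<in> \<phi> ` \<tau>. pos u < pos (\<phi> i)} = card {u \<in> \<tau>. pos' u < pos' i}"
    by (simp add: card_image inj_on_subset[OF assms(1)])
  moreover have "\<phi> ` \<tau> - {\<phi> i} = \<phi> ` (\<tau> - {i})"
    using assms(1) i by (auto simp: inj_on_def)
  ultimately show "order_sign pos' \<tau> i * (x' i ^ n * g' (\<tau> - {i})) =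
    order_sign pos (\<phi> ` \<tau>) (\<phi> i) * (x (\<phi> i) ^ n * g (\<phi> ` \<tau> - {\<phi> i}))"
    using i assms(2) g by (simp add: order_sign_def)
qed

text \<open>
  The complex is indexed by sets of positions in a list; this lemma passes to sets of vertices and
  back.
\<close>

lemma has_class_reindex:
  assumes inj: "inj_on \<phi> V'" and img: "\<phi> ` V' = V"
    and x: "\<And>i. i \<in> V' \<Longrightarrow> x' i = x (\<phi> i)" and pos: "\<And>i. i \<in> V' \<Longrightarrow> pos' i = pos (\<phi> i)"
    and cls: "has_class C I V x pos p"
  shows "has_class C I V' x' pos' p"
proof -
  obtain n g where cocycle: "is_cocycle C I V x pos p n g"
    and no_cob: "\<not> is_coboundary C I V x pos p n g"
    using cls by (auto simp: has_class_def)
  define \<psi> where "\<psi> = inv_into V' \<phi>"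
  have \<psi>: "\<psi> ` V = V'" and \<phi>\<psi>: "\<And>v. v \<in> V \<Longrightarrow> \<phi> (\<psi> v) = v"
    using inj img inv_into_f_f[OF inj] f_inv_into_f[of _ \<phi> V']
    by (auto simp: \<psi>_def image_image cong: image_cong)
  have inj\<psi>: "inj_on \<psi> V" using \<phi>\<psi> by (metis inj_onI)
  have prod': "prod x' \<tau> = prod x (\<phi> ` \<tau>)" if "\<tau> \<subseteq> V'" for \<tau>
    using that x by (subst prod.reindex[OF inj_on_subset[OF inj that]]) (auto intro: prod.cong)
  define g' where "g' \<sigma> = g (\<phi> ` \<sigma>)" for \<sigma>
  have nd: "num_diff x' pos' n g' \<tau> = num_diff x pos n g (\<phi> ` \<tau>)" if "\<tau> \<subseteq> V'" for \<tau>
    using that x pos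
    by (intro num_diff_reindex[OF inj_on_subset[OF inj that]]) (auto simp: g'_def)
  have card': "card (\<phi> ` \<tau>) = card \<tau>" "\<phi> ` \<tau> \<subseteq> V" if "\<tau> \<subseteq> V'" for \<tau>
    using that img by (auto simp: card_image inj_on_subset[OF inj])
  have "is_cocycle C I V' x' pos' p n g'"
    using cocycle unfolding is_cocycle_def by (simp add: prod' nd card' g'_def)
  moreover have "is_coboundary C I V x pos p n g" if cob': "is_coboundary C I V' x' pos' p n g'"
  proof -
    obtain m h where h: "\<forall>\<sigma>. h \<sigma> \<in> C"
      and cob: "\<forall>\<sigma>. \<sigma> \<subseteq> V' \<and> card \<sigma> = p \<longrightarrow> (\<exists>k. prod x' \<sigma> ^ k *
         (prod x' \<sigma> ^ m * g' \<sigma> - prod x' \<sigma> ^ n * num_diff x' pos' m h \<sigma>) \<in> I)"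
      using cob' unfolding is_coboundary_def by blast
    have "\<exists>k. prod x \<sigma> ^ k *
         (prod x \<sigma> ^ m * g \<sigma> - prod x \<sigma> ^ n * num_diff x pos m (\<lambda>\<rho>. h (\<psi> ` \<rho>)) \<sigma>) \<in> I"
      if \<sigma>: "\<sigma> \<subseteq> V" "card \<sigma> = p" for \<sigma>
    proof -
      have sub: "\<psi> ` \<sigma> \<subseteq> V'" using \<psi> \<sigma> by auto
      have \<phi>\<psi>_img: "\<phi> ` \<psi> ` \<sigma> = \<sigma>" using \<phi>\<psi> \<sigma> by (force simp: image_image)
      have "num_diff x pos m (\<lambda>\<rho>. h (\<psi> ` \<rho>)) \<sigma> = num_diff x' pos' m h (\<psi> ` \<sigma>)"
        using \<sigma> sub by (intro num_diff_reindex inj_on_subset[OF inj\<psi>]) (auto simp: x pos \<phi>\<psi> subset_iff)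
      moreover have "card (\<psi> ` \<sigma>) = p"
        using \<sigma> by (simp add: card_image inj_on_subset[OF inj\<psi>])
      ultimately show ?thesis
        using cob[rule_format, of "\<psi> ` \<sigma>"] sub by (simp add: prod' g'_def \<phi>\<psi>_img)
    qed
    then show ?thesis unfolding is_coboundary_def using h by (intro exI[of _ m] exI[of _ "\<lambda>\<rho>. h (\<psi> ` \<rho>)"]) simp
  qed
  ultimately show ?thesis using no_cob unfolding has_class_def by blast
qed

section \<open>Signs of orderings\<close>

lemma order_sign_square: "order_sign pos \<tau> v * order_sign pos \<tau> v = 1"
  by (simp add: order_sign_def flip: power_mult_distrib)

text \<open>
  This identity of signs is what makes the Cech differential square to zero.
\<close>

lemma order_sign_anticommute:
  assumes fin: "finite \<tau>" and inj: "inj_on pos \<tau>" and pq: "p \<in> \<tau>" "q \<in> \<tau>" "p \<noteq> q"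
  shows "order_sign pos \<tau> p * order_sign pos (\<tau> - {p}) q
    = - (order_sign pos \<tau> q * order_sign pos (\<tau> - {q}) p)"
proof -
  have *: "order_sign pos \<tau> p * order_sign pos (\<tau> - {p}) q
    = - (order_sign pos \<tau> q * order_sign pos (\<tau> - {q}) p)"
    if "p \<in> \<tau>" "q \<in> \<tau>" "pos p < pos q" for p q
  proof -
    have "{u \<in> \<tau>. pos u < pos q} = insert p {u \<in> \<tau> - {p}. pos u < pos q}"
      using that by auto
    moreover have "{u \<in> \<tau> - {q}. pos u < pos p} = {u \<in> \<tau>. pos u < pos p}"
      using that by auto
    ultimately show ?thesis using fin by (simp add: order_sign_def)
  qed
  have "pos p < pos q \<or> pos q < pos p"
    using inj pq by (meson inj_onD linorder_neqE_nat)
  then show ?thesis using *[OF pq(1,2)] *[OF pq(2,1)] by (metis minus_minus)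
qed

text \<open>
  The lists of variables of the two polynomial rings may order the common variables differently.
  Multiplying the entry at \<open>\<sigma>\<close> by the parity of the number of pairs in \<open>\<sigma>\<close> that are ordered
  differently passes from one sign convention to the other.
\<close>

definition inversion_sign :: "('i \<Rightarrow> nat) \<Rightarrow> ('i \<Rightarrow> nat) \<Rightarrow> 'i set \<Rightarrow> 'r::comm_ring_1" where
  "inversion_sign pos pos' \<sigma> = (- 1) ^ card {(i, j) \<in> \<sigma> \<times> \<sigma>. pos i < pos j \<and> pos' j < pos' i}"

lemma inversion_sign_square: "inversion_sign pos pos' \<sigma> * inversion_sign pos pos' \<sigma> = 1"
  by (simp add: inversion_sign_def flip: power_mult_distrib)

text \<open>
  A pair that contains \<open>v\<close> is inverted if its other element comes before \<open>v\<close> in exactly one of the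
  two orderings. The number of these elements has the parity of the sum of the two positions of
  \<open>v\<close> in \<open>\<sigma>\<close>, since the elements before \<open>v\<close> in both orderings are counted twice.
\<close>

lemma inversion_sign_remove:
  assumes fin: "finite \<sigma>" and inj: "inj_on pos \<sigma>" "inj_on pos' \<sigma>" and v: "v \<in> \<sigma>"
  shows "inversion_sign pos pos' (\<sigma> - {v})
    = (inversion_sign pos pos' \<sigma> * (order_sign pos \<sigma> v * order_sign pos' \<sigma> v) :: 'r::comm_ring_1)"
proof -
  let ?inv = "\<lambda>\<sigma>. {(i, j) \<in> \<sigma> \<times> \<sigma>. pos i < pos j \<and> pos' j < pos' i}"
  define LU where "LU = {i \<in> \<sigma>. pos i < pos v \<and> pos' v < pos' i}"
  define UL where "UL = {j \<in> \<sigma>. pos v < pos j \<and> pos' j < pos' v}"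
  define LL where "LL = {j \<in> \<sigma>. pos j < pos v \<and> pos' j < pos' v}"
  have fins: "finite LU" "finite UL" "finite LL" using fin by (auto simp: LU_def UL_def LL_def)
  have ne: "pos i \<noteq> pos v" "pos' i \<noteq> pos' v" if "i \<in> \<sigma>" "i \<noteq> v" for i
    using inj that v by (auto simp: inj_on_def)
  have "?inv \<sigma> = ?inv (\<sigma> - {v}) \<union> ((\<lambda>i. (i, v)) ` LU \<union> (\<lambda>j. (v, j)) ` UL)"
    using v by (auto simp: LU_def UL_def)
  moreover have "card (?inv (\<sigma> - {v}) \<union> ((\<lambda>i. (i, v)) ` LU \<union> (\<lambda>j. (v, j)) ` UL))
     = card (?inv (\<sigma> - {v})) + (card LU + card UL)"
  proof -
    have "finite (?inv (\<sigma> - {v}))"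
      by (rule finite_subset[of _ "\<sigma> \<times> \<sigma>"]) (use fin in auto)
    moreover have "card ((\<lambda>i. (i, v)) ` LU \<union> (\<lambda>j. (v, j)) ` UL) = card LU + card UL"
      using fins by (subst card_Un_disjoint) (auto simp: card_image inj_on_def LU_def UL_def)
    ultimately show ?thesis
      using fins by (subst card_Un_disjoint) auto
  qed
  ultimately have inv: "card (?inv \<sigma>) = card (?inv (\<sigma> - {v})) + (card LU + card UL)" by simp
  have cmp: "pos u < pos v \<or> pos v < pos u" "pos' u < pos' v \<or> pos' v < pos' u"
    if "u \<in> \<sigma>" "u \<noteq> v" for u
    using ne[OF that] by linarith+
  have L_eq: "{u \<in> \<sigma>. pos u < pos v} = LU \<union> LL" and L'_eq: "{u \<in> \<sigma>. pos' u < pos' v} = UL \<union> LL"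
    using cmp by (auto simp: LU_def UL_def LL_def)
  have L: "card {u \<in> \<sigma>. pos u < pos v} = card LU + card LL"
    unfolding L_eq using fins by (intro card_Un_disjoint) (auto simp: LU_def LL_def)
  have L': "card {u \<in> \<sigma>. pos' u < pos' v} = card UL + card LL"
    unfolding L'_eq using fins by (intro card_Un_disjoint) (auto simp: UL_def LL_def)
  have sq: "(- 1 :: 'r) ^ k * ((- 1) ^ k * z) = z" for k z
    by (simp add: mult.assoc[symmetric] flip: power_mult_distrib)
  show ?thesis
    unfolding inversion_sign_def order_sign_def inv L L' power_add
    by (simp add: sq mult_ac)
qed

section \<open>Suspending a cohomology class\<close>

text \<open>
  The setting abstracts the ring-theoretic part of the argument. The ring \<open>R\<close> with its ideal \<open>K\<close> belongs
  to the indices \<open>W\<close>, the larger ring \<open>S\<close> with \<open>J\<close> to the indices \<open>V\<close>, and \<open>f\<close> maps \<open>R/K\<close> to \<open>S/J\<close> by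
  multiplication. For an apex \<open>c\<close>, which is \<open>a\<close> or \<open>b\<close>, the map \<open>P c n\<close> stands for taking the
  coefficient of \<open>f (x c)\<^sup>n\<close>; by \<open>P_shift\<close> and \<open>P_J\<close> it induces a map from the localization of \<open>S/J\<close> at \<open>x c\<close> to
  \<open>R/K\<close>. Since the coefficient of \<open>f\<close> does not refer to the apex, the two maps agree on \<open>S\<close>.
\<close>

locale suspension = sub: quotient_of_subring R K + big: quotient_of_subring S J
  for R K S J :: "'r::comm_ring_1 set" +
  fixes x :: "'v \<Rightarrow> 'r" and W V B\<^sub>1 B\<^sub>2 :: "'v set" and a b :: 'v and f :: 'r
    and P :: "'v \<Rightarrow> nat \<Rightarrow> 'r \<Rightarrow> 'r" and posW posV :: "'v \<Rightarrow> nat"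
  assumes finite_V: "finite V" and V_split: "V = W \<union> (B\<^sub>1 \<union> B\<^sub>2)" "W \<inter> (B\<^sub>1 \<union> B\<^sub>2) = {}" "B\<^sub>1 \<inter> B\<^sub>2 = {}"
    and a: "a \<in> B\<^sub>1" and b: "b \<in> B\<^sub>2"
    and posW: "inj_on posW W" and posV: "inj_on posV V"
    and R_S: "R \<subseteq> S" and x_R: "\<And>v. v \<in> W \<Longrightarrow> x v \<in> R" and x_S: "\<And>v. v \<in> V \<Longrightarrow> x v \<in> S"
    and f_S: "f \<in> S" and f_K: "\<And>k. k \<in> K \<Longrightarrow> f * k \<in> J"
    and cross: "\<And>p q. p \<in> B\<^sub>1 \<Longrightarrow> q \<in> B\<^sub>2 \<Longrightarrow> x p * x q * f \<in> J"
    and P_R: "\<And>c n s. s \<in> S \<Longrightarrow> P c n s \<in> R"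
    and P_add: "\<And>c n s s'. P c n (s + s') = P c n s + P c n s'"
    and P_mult: "\<And>c n r s. c = a \<or> c = b \<Longrightarrow> r \<in> R \<Longrightarrow> P c n (r * s) = r * P c n s"
    and P_shift: "\<And>c n m s. P c (n + m) (x c ^ m * s) = P c n s"
    and P_base: "\<And>s. P a 0 s = P b 0 s" and P_f: "P a 0 f = 1"
    and P_J: "\<And>c n s. c = a \<or> c = b \<Longrightarrow> s \<in> J \<Longrightarrow> P c n s \<in> K"
begin

context
  fixes c assumes c: "c = a \<or> c = b"
begin

lemma P_minus: "P c n (- s) = - P c n s"
  using P_mult[OF c, of "- 1" n s] sub.minus_C sub.one_C by simp

lemma P_zero: "P c n 0 = 0"
  using P_mult[OF c, of 0 n 0] sub.zero_C by simp

lemma P_sum: "P c n (sum s T) = (\<Sum>i\<in>T. P c n (s i))"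
  by (induction T rule: infinite_finite_induct) (simp_all add: P_zero P_add)

end

abbreviation \<epsilon> where "\<epsilon> \<equiv> order_sign posV"
abbreviation \<eta> where "\<eta> \<equiv> inversion_sign posW posV"

lemma sign_R: "order_sign pos \<tau> v \<in> R" "inversion_sign pos pos' \<sigma> \<in> R"
  by (simp_all add: order_sign_def inversion_sign_def sub.C_closed)

lemma sign_S: "order_sign pos \<tau> v \<in> S" "inversion_sign pos pos' \<sigma> \<in> S"
  by (simp_all add: order_sign_def inversion_sign_def big.C_closed)

text \<open>
  The entry at \<open>\<sigma> \<union> {q}\<close>, with \<open>q \<in> B\<^sub>1\<close>, is \<open>\<plusminus> f z(\<sigma>)\<close>, where \<open>z(\<sigma>) = g \<sigma> / x\<^sub>\<sigma>\<^sup>n\<close>; the factor \<open>(x q)\<^sup>n\<close>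
  comes from the larger denominator. In the degree of \<open>f\<close> this is the connecting map of
  a suspension: the coboundary of \<open>\<plusminus> f z\<close>, extended by zero, on the index sets that avoid \<open>B\<^sub>2\<close>, and zero
  on those that avoid \<open>B\<^sub>1\<close>.
\<close>

definition lift :: "nat \<Rightarrow> ('v set \<Rightarrow> 'r) \<Rightarrow> 'v set \<Rightarrow> 'r" where
  "lift n g \<tau> = (if \<exists>q\<in>B\<^sub>1. \<tau> - W = {q} then
     (let q = the_elem (\<tau> - W) in \<epsilon> \<tau> q * \<eta> (\<tau> - {q}) * (f * (x q ^ n * g (\<tau> - {q})))) else 0)"

lemma lift_insert:
  assumes "\<sigma> \<subseteq> W" "q \<in> B\<^sub>1"
  shows "lift n g (insert q \<sigma>) = \<epsilon> (insert q \<sigma>) q * \<eta> \<sigma> * (f * (x q ^ n * g \<sigma>))"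
proof -
  have "insert q \<sigma> - W = {q}" "insert q \<sigma> - {q} = \<sigma>" using assms V_split by auto
  then show ?thesis using assms by (simp add: lift_def)
qed

lemma lift_zero: "\<not> (\<exists>q\<in>B\<^sub>1. \<tau> - W = {q}) \<Longrightarrow> lift n g \<tau> = 0"
  by (simp add: lift_def)

lemma lift_S:
  assumes "\<And>\<sigma>. g \<sigma> \<in> R"
  shows "lift n g \<tau> \<in> S"
proof -
  have S: "\<epsilon> \<tau>' v \<in> S" "\<eta> \<tau>' \<in> S" "g \<tau>' \<in> S" for \<tau>' v using sign_S assms R_S by auto
  have "x q \<in> S" if "q \<in> B\<^sub>1" for q using that x_S V_split(1) by auto
  then show ?thesis using S f_S by (auto simp: lift_def intro!: big.C_closed)
qed

text \<open>
  Only those \<open>\<tau>\<close> matter for which \<open>\<tau> - W\<close> has one or two indices. If it is one index of \<open>B\<^sub>1\<close>, the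
  differential is \<open>f\<close> times that of \<open>z\<close>, up to sign. If it consists of two indices of
  \<open>B\<^sub>1\<close>, the two terms cancel. If it consists of \<open>q \<in> B\<^sub>1\<close> and \<open>r \<in> B\<^sub>2\<close>, the single term is zero in the
  localization since \<open>x q * x r * f \<in> J\<close>.
\<close>

lemma lift_cocycle:
  assumes g: "\<And>\<sigma>. g \<sigma> \<in> R"
    and cocycle: "\<And>\<tau>. \<tau> \<subseteq> W \<Longrightarrow> card \<tau> = Suc p \<Longrightarrow> \<exists>k. prod x \<tau> ^ k * num_diff x posW n g \<tau> \<in> K"
    and \<tau>: "\<tau> \<subseteq> V" "card \<tau> = Suc (Suc p)"
  shows "\<exists>k. prod x \<tau> ^ k * num_diff x posV n (lift n g) \<tau> \<in> J"
proof -
  define \<sigma> where "\<sigma> = \<tau> \<inter> W"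
  have fin: "finite \<tau>" "finite \<sigma>"
    using finite_subset[OF \<tau>(1) finite_V] by (auto simp: \<sigma>_def)
  have inj: "inj_on posV \<tau>" "inj_on posV \<sigma>" "inj_on posW \<sigma>"
    using inj_on_subset[OF posV \<tau>(1)] inj_on_subset[OF posV \<tau>(1), THEN inj_on_subset, of \<sigma>]
      inj_on_subset[OF posW, of \<sigma>] by (auto simp: \<sigma>_def)
  have \<sigma>W: "\<sigma> \<subseteq> W" by (auto simp: \<sigma>_def)
  have S: "\<epsilon> \<tau>' v \<in> S" "\<eta> \<tau>' \<in> S" "g \<tau>' \<in> S" for \<tau>' v using sign_S g R_S by auto
  have xS: "x v \<in> S" if "v \<in> \<tau>" for v using x_S \<tau>(1) that by blast
  consider (one) q where "q \<in> B\<^sub>1" "\<tau> - W = {q}"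
    | (two) q r where "q \<in> B\<^sub>1" "q \<noteq> r" "\<tau> - W = {q, r}"
    | (other) "\<not> (\<exists>q\<in>B\<^sub>1. \<exists>v. q \<in> \<tau> - W \<and> \<tau> - W \<subseteq> {q, v})"
  proof (cases "\<exists>q\<in>B\<^sub>1. \<exists>v. q \<in> \<tau> - W \<and> \<tau> - W \<subseteq> {q, v}")
    case True
    then obtain q v where q: "q \<in> B\<^sub>1" "q \<in> \<tau> - W" "\<tau> - W \<subseteq> {q, v}" by blast
    show ?thesis
    proof (cases "\<tau> - W = {q}")
      case False
      then have "\<tau> - W = {q, v}" "q \<noteq> v" using q by blast+
      then show ?thesis using two q(1) by blast
    qed (rule one[OF q(1)])
  qed (rule other, assumption)
  then show ?thesis
  proof cases
    case one
    have \<tau>_eq: "\<tau> = insert q \<sigma>" and q: "q \<notin> \<sigma>" using one by (auto simp: \<sigma>_def)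
    have \<sigma>_eq: "\<tau> - {q} = \<sigma>" using \<tau>_eq q by auto
    have "card \<sigma> = Suc p" using \<tau> q fin unfolding \<tau>_eq by simp
    then obtain k where k: "prod x \<sigma> ^ k * num_diff x posW n g \<sigma> \<in> K"
      using cocycle \<sigma>W by blast
    have "\<epsilon> \<tau> v * (x v ^ n * lift n g (\<tau> - {v})) =
       - (\<epsilon> \<tau> q * \<eta> \<sigma> * x q ^ n * f) * (order_sign posW \<sigma> v * (x v ^ n * g (\<sigma> - {v})))"
      if v: "v \<in> \<sigma>" for v
    proof -
      have ins: "\<tau> - {v} = insert q (\<sigma> - {v})" using \<tau>_eq q v by auto
      have "v \<in> \<tau>" "q \<in> \<tau>" "v \<noteq> q" using \<tau>_eq q v by auto
      then have anti: "\<epsilon> \<tau> v * \<epsilon> (\<tau> - {v}) q = - (\<epsilon> \<tau> q * \<epsilon> \<sigma> v :: 'r)"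
        using order_sign_anticommute[OF fin(1) inj(1)] \<sigma>_eq by metis
      have "\<epsilon> \<tau> v * \<epsilon> (\<tau> - {v}) q * \<eta> (\<sigma> - {v})
         = - (\<epsilon> \<tau> q * \<epsilon> \<sigma> v) * (\<eta> \<sigma> * (order_sign posW \<sigma> v * \<epsilon> \<sigma> v) :: 'r)"
        unfolding anti inversion_sign_remove[OF fin(2) inj(3,2) v] ..
      also have "\<dots> = - (\<epsilon> \<tau> q * \<eta> \<sigma> * order_sign posW \<sigma> v) * (\<epsilon> \<sigma> v * \<epsilon> \<sigma> v)"
        by (simp add: algebra_simps)
      finally have sgn: "\<epsilon> \<tau> v * \<epsilon> (\<tau> - {v}) q * \<eta> (\<sigma> - {v}) = - (\<epsilon> \<tau> q * \<eta> \<sigma> * order_sign posW \<sigma> v :: 'r)"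
        by (simp add: order_sign_square)
      have "lift n g (\<tau> - {v}) = \<epsilon> (\<tau> - {v}) q * \<eta> (\<sigma> - {v}) * (f * (x q ^ n * g (\<sigma> - {v})))"
        unfolding ins using \<sigma>W one by (intro lift_insert) auto
      then have "\<epsilon> \<tau> v * (x v ^ n * lift n g (\<tau> - {v})) =
        (\<epsilon> \<tau> v * \<epsilon> (\<tau> - {v}) q * \<eta> (\<sigma> - {v})) * (x v ^ n * (f * (x q ^ n * g (\<sigma> - {v}))))"
        by (simp add: mult_ac)
      then show ?thesis unfolding sgn by (simp add: mult_ac)
    qed
    moreover have "lift n g (\<tau> - {q}) = 0"
      unfolding \<sigma>_eq using \<sigma>W by (intro lift_zero) auto
    ultimately have nd: "num_diff x posV n (lift n g) \<tau> =
       - (\<epsilon> \<tau> q * \<eta> \<sigma> * x q ^ n * f) * num_diff x posW n g \<sigma>"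
      unfolding num_diff_def sum_distrib_left using fin q
      by (subst \<tau>_eq, subst sum.insert) (auto simp: \<tau>_eq[symmetric])
    have pr: "prod x \<tau> = x q * prod x \<sigma>" using \<tau>_eq q fin by simp
    have "- (\<epsilon> \<tau> q * \<eta> \<sigma> * x q ^ n * x q ^ k) * (f * (prod x \<sigma> ^ k * num_diff x posW n g \<sigma>)) \<in> J"
      using k S \<tau>_eq by (intro big.mult_I f_K big.C_closed xS) auto
    then have "prod x \<tau> ^ k * num_diff x posV n (lift n g) \<tau> \<in> J"
      by (simp add: nd pr power_mult_distrib mult_ac)
    then show ?thesis by blast
  next
    case two
    have \<tau>_eq: "\<tau> = insert q (insert r \<sigma>)" and qr: "q \<notin> \<sigma>" "r \<notin> \<sigma>" "r \<notin> W"
      using two by (auto simp: \<sigma>_def)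
    have rB: "r \<in> B\<^sub>1 \<or> r \<in> B\<^sub>2" using two \<tau> V_split by blast
    have eqs: "\<tau> - {r} = insert q \<sigma>" "\<tau> - {q} = insert r \<sigma>" using \<tau>_eq qr two by auto
    have "lift n g (\<tau> - {v}) = 0" if "v \<in> \<sigma>" for v
    proof (rule lift_zero)
      have "\<tau> - {v} - W = {q, r}" using two that \<sigma>W by auto
      then show "\<not> (\<exists>q\<in>B\<^sub>1. \<tau> - {v} - W = {q})" using two(2) by auto
    qed
    then have "(\<Sum>v\<in>\<sigma>. \<epsilon> \<tau> v * (x v ^ n * lift n g (\<tau> - {v}))) = 0" by simp
    then have nd: "num_diff x posV n (lift n g) \<tau> =
       \<epsilon> \<tau> q * (x q ^ n * lift n g (\<tau> - {q})) + \<epsilon> \<tau> r * (x r ^ n * lift n g (\<tau> - {r}))"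
      unfolding num_diff_def using fin qr two(2)
      by (subst \<tau>_eq, subst sum.insert, simp, simp, subst sum.insert) (auto simp: \<tau>_eq[symmetric])
    have lr: "lift n g (\<tau> - {r}) = \<epsilon> (\<tau> - {r}) q * \<eta> \<sigma> * (f * (x q ^ n * g \<sigma>))"
      unfolding eqs using \<sigma>W two by (intro lift_insert)
    show ?thesis
    proof (cases "r \<in> B\<^sub>1")
      case True
      have lq: "lift n g (\<tau> - {q}) = \<epsilon> (\<tau> - {q}) r * \<eta> \<sigma> * (f * (x r ^ n * g \<sigma>))"
        unfolding eqs using \<sigma>W True by (intro lift_insert)
      have "q \<in> \<tau>" "r \<in> \<tau>" using \<tau>_eq by auto
      then have "\<epsilon> \<tau> q * \<epsilon> (\<tau> - {q}) r = - (\<epsilon> \<tau> r * \<epsilon> (\<tau> - {r}) q :: 'r)"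
        by (rule order_sign_anticommute[OF fin(1) inj(1) _ _ two(2)])
      then have cancel: "\<epsilon> \<tau> q * \<epsilon> (\<tau> - {q}) r + \<epsilon> \<tau> r * \<epsilon> (\<tau> - {r}) q = (0::'r)"
        by (simp add: eq_neg_iff_add_eq_0)
      have "num_diff x posV n (lift n g) \<tau> =
        (\<epsilon> \<tau> q * \<epsilon> (\<tau> - {q}) r + \<epsilon> \<tau> r * \<epsilon> (\<tau> - {r}) q) * (\<eta> \<sigma> * f * x q ^ n * x r ^ n * g \<sigma>)"
        unfolding nd lr lq by (simp add: algebra_simps)
      then show ?thesis unfolding cancel using big.zero_I by simp
    next
      case False
      then have r: "r \<in> B\<^sub>2" using rB by simp
      have "\<not> (\<exists>q'\<in>B\<^sub>1. \<tau> - {q} - W = {q'})" using eqs(2) qr(3) \<sigma>W False by auto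
      then have "lift n g (\<tau> - {q}) = 0" by (rule lift_zero)
      then have nd': "num_diff x posV n (lift n g) \<tau>
         = (\<epsilon> \<tau> r * x r ^ n * (\<epsilon> (\<tau> - {r}) q * \<eta> \<sigma> * (x q ^ n * g \<sigma>))) * f"
        unfolding nd lr by (simp add: mult_ac)
      have pr: "prod x \<tau> = x q * x r * prod x \<sigma>" using \<tau>_eq qr two(2) fin by (simp add: mult_ac)
      \<comment> \<open>One power of the denominator supplies the factor \<open>x q * x r\<close>.\<close>
      have "(prod x \<sigma> * (\<epsilon> \<tau> r * x r ^ n * (\<epsilon> (\<tau> - {r}) q * \<eta> \<sigma> * (x q ^ n * g \<sigma>)))) * (x q * x r * f) \<in> J"
        using S \<tau>_eq by (intro big.mult_I cross two r big.C_closed big.prod_C xS) auto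
      then have "prod x \<tau> ^ 1 * num_diff x posV n (lift n g) \<tau> \<in> J"
        unfolding nd' pr by (simp add: mult_ac)
      then show ?thesis by blast
    qed
  next
    case other
    have "lift n g (\<tau> - {v}) = 0" if v: "v \<in> \<tau>" for v
    proof (rule lift_zero, clarify)
      fix q assume q: "q \<in> B\<^sub>1" "\<tau> - {v} - W = {q}"
      then have "\<tau> - W \<subseteq> {q, v}" "q \<in> \<tau> - W" by auto
      then show False using other q by blast
    qed
    then have "num_diff x posV n (lift n g) \<tau> = 0" by (simp add: num_diff_def)
    then show ?thesis using big.zero_I by simp
  qed
qed

text \<open>
  For a cochain of \<open>S/J\<close> with numerators \<open>h\<close> and exponent \<open>m\<close>, these are the numerators of the cochain of \<open>R/K\<close>
  that reads off the part in the degree of \<open>f\<close> at the index sets containing the apex \<open>c\<close>.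
\<close>

definition slice :: "nat \<Rightarrow> ('v set \<Rightarrow> 'r) \<Rightarrow> 'v \<Rightarrow> 'v set \<Rightarrow> 'r" where
  "slice m h c \<rho> = \<epsilon> (insert c \<rho>) c * P c m (h (insert c \<rho>))"

text \<open>
  The relation \<open>lift = \<delta> h\<close> at \<open>\<sigma> \<union> {c}\<close>, read off in the degree of \<open>f\<close>. The left-hand side gives
  \<open>\<plusminus> g \<sigma>\<close> for the apex \<open>a\<close> and nothing for \<open>b\<close>; removing \<open>c\<close> gives the term of \<open>h \<sigma>\<close>, which is the
  same for both apexes; removing an element of \<open>\<sigma>\<close> gives the differential of the slice.
\<close>

lemma slice_relation:
  assumes g: "\<And>\<sigma>. g \<sigma> \<in> R" and h: "\<And>\<sigma>. h \<sigma> \<in> S"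
    and c: "c = a \<or> c = b" and \<sigma>: "\<sigma> \<subseteq> W" "finite \<sigma>"
    and k: "prod x (insert c \<sigma>) ^ k * (prod x (insert c \<sigma>) ^ m * lift n g (insert c \<sigma>)
      - prod x (insert c \<sigma>) ^ n * num_diff x posV m h (insert c \<sigma>)) \<in> J"
  shows "prod x \<sigma> ^ k * (prod x \<sigma> ^ m * ((if c = a then 1 else 0) * \<eta> \<sigma> * g \<sigma>)
     - prod x \<sigma> ^ n * (P a 0 (h \<sigma>) - num_diff x posV m (slice m h c) \<sigma>)) \<in> K"
proof -
  define \<tau> where "\<tau> = insert c \<sigma>"
  define \<delta> where "\<delta> = (if c = a then 1 else 0 :: 'r)"
  \<comment> \<open>The element of \<open>J\<close> in the hypothesis. The coefficient read off is that of \<open>f (x c)\<^sup>m\<^sup>+\<^sup>k\<^sup>+\<^sup>n\<close>.\<close>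
  define E where "E = prod x \<tau> ^ k * (prod x \<tau> ^ m * lift n g \<tau> - prod x \<tau> ^ n * num_diff x posV m h \<tau>)"
  have cV: "c \<in> V" "c \<notin> W" using c a b V_split by auto
  have c\<sigma>: "c \<notin> \<sigma>" using cV \<sigma> by auto
  have \<tau>V: "\<tau> \<subseteq> V" using cV \<sigma> V_split by (auto simp: \<tau>_def)
  have fin: "finite \<tau>" using \<sigma> by (simp add: \<tau>_def)
  have inj: "inj_on posV \<tau>" using posV \<tau>V by (rule inj_on_subset)
  have \<tau>c: "\<tau> - {c} = \<sigma>" using c\<sigma> by (auto simp: \<tau>_def)
  have pr: "prod x \<tau> = x c * prod x \<sigma>" using c\<sigma> \<sigma> by (simp add: \<tau>_def)
  have XR: "prod x \<sigma> \<in> R" using \<sigma> by (auto intro!: sub.prod_C x_R)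
  have \<delta>R: "\<delta> \<in> R" by (simp add: \<delta>_def sub.C_closed)
  have lift: "\<epsilon> \<tau> c * lift n g \<tau> = \<delta> * \<eta> \<sigma> * (f * (x c ^ n * g \<sigma>))"
  proof (cases "c = a")
    case True
    then show ?thesis using lift_insert[OF \<sigma>(1) a, of n g]
      by (simp add: \<tau>_def \<delta>_def mult.assoc[symmetric] order_sign_square)
  next
    case False
    then have "\<not> (\<exists>q\<in>B\<^sub>1. \<tau> - W = {q})" using c b cV V_split(3) \<sigma> by (auto simp: \<tau>_def)
    then show ?thesis using False by (simp add: lift_zero \<delta>_def)
  qed
  have sgn: "\<epsilon> \<tau> c * \<epsilon> \<tau> v = - (\<epsilon> \<sigma> v * \<epsilon> (\<tau> - {v}) c :: 'r)" if "v \<in> \<sigma>" for v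
  proof -
    have "(\<epsilon> \<tau> c * \<epsilon> \<sigma> v) = - (\<epsilon> \<tau> v * \<epsilon> (\<tau> - {v}) c :: 'r)"
      using order_sign_anticommute[OF fin inj, of c v] that c\<sigma> \<tau>c by (auto simp: \<tau>_def)
    then have "(\<epsilon> \<tau> c * \<epsilon> \<sigma> v) * (\<epsilon> \<sigma> v * \<epsilon> \<tau> v) = - (\<epsilon> \<tau> v * \<epsilon> (\<tau> - {v}) c :: 'r) * (\<epsilon> \<sigma> v * \<epsilon> \<tau> v)"
      by simp
    also have "(\<epsilon> \<tau> c * \<epsilon> \<sigma> v) * (\<epsilon> \<sigma> v * \<epsilon> \<tau> v) = (\<epsilon> \<sigma> v * \<epsilon> \<sigma> v) * (\<epsilon> \<tau> c * \<epsilon> \<tau> v :: 'r)"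
      by (simp add: mult_ac)
    also have "- (\<epsilon> \<tau> v * \<epsilon> (\<tau> - {v}) c :: 'r) * (\<epsilon> \<sigma> v * \<epsilon> \<tau> v)
       = (\<epsilon> \<tau> v * \<epsilon> \<tau> v) * - (\<epsilon> \<sigma> v * \<epsilon> (\<tau> - {v}) c)"
      by (simp add: mult_ac)
    finally show ?thesis by (simp add: order_sign_square)
  qed
  have "\<epsilon> \<tau> c * num_diff x posV m h \<tau> = \<epsilon> \<tau> c * \<epsilon> \<tau> c * (x c ^ m * h \<sigma>)
      + (\<Sum>v\<in>\<sigma>. \<epsilon> \<tau> c * \<epsilon> \<tau> v * (x v ^ m * h (\<tau> - {v})))"
    unfolding num_diff_def using \<sigma>(2) c\<sigma>
    by (subst \<tau>_def, subst sum.insert)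
       (auto simp: \<tau>_def[symmetric] \<tau>c algebra_simps sum_distrib_left)
  also have "(\<Sum>v\<in>\<sigma>. \<epsilon> \<tau> c * \<epsilon> \<tau> v * (x v ^ m * h (\<tau> - {v})))
     = - (\<Sum>v\<in>\<sigma>. \<epsilon> \<sigma> v * \<epsilon> (\<tau> - {v}) c * (x v ^ m * h (\<tau> - {v})))"
    by (simp add: sgn sum_negf)
  finally have nd: "\<epsilon> \<tau> c * num_diff x posV m h \<tau> = x c ^ m * h \<sigma>
     - (\<Sum>v\<in>\<sigma>. \<epsilon> \<sigma> v * \<epsilon> (\<tau> - {v}) c * (x v ^ m * h (\<tau> - {v})))"
    by (simp add: order_sign_square)
  \<comment> \<open>Up to sign and powers of \<open>x c\<close>, the terms of \<open>E\<close> are \<open>r\<^sub>1 f\<close>, \<open>r\<^sub>2 h(\<sigma>)\<close> and \<open>r\<^sub>2 r\<^sub>3(v) h(\<tau> - {v})\<close>.\<close>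
  define r\<^sub>1 where "r\<^sub>1 = prod x \<sigma> ^ (k + m) * (\<delta> * \<eta> \<sigma> * g \<sigma>)"
  define r\<^sub>2 where "r\<^sub>2 = prod x \<sigma> ^ (k + n)"
  define r\<^sub>3 where "r\<^sub>3 v = \<epsilon> \<sigma> v * \<epsilon> (\<tau> - {v}) c * x v ^ m" for v
  have rR: "r\<^sub>1 \<in> R" "r\<^sub>2 \<in> R" "\<And>v. v \<in> \<sigma> \<Longrightarrow> r\<^sub>3 v \<in> R"
    unfolding r\<^sub>1_def r\<^sub>2_def r\<^sub>3_def using XR \<delta>R g sign_R \<sigma>
    by (auto intro!: sub.C_closed x_R)
  have "\<epsilon> \<tau> c * E = prod x \<tau> ^ k * (prod x \<tau> ^ m * (\<epsilon> \<tau> c * lift n g \<tau>)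
       - prod x \<tau> ^ n * (\<epsilon> \<tau> c * num_diff x posV m h \<tau>))"
    by (simp add: E_def algebra_simps)
  also have "\<dots> = x c ^ (m + (k + n)) * (r\<^sub>1 * f) + - (x c ^ (m + (k + n)) * (r\<^sub>2 * h \<sigma>))
     + x c ^ (k + n) * (r\<^sub>2 * (\<Sum>v\<in>\<sigma>. r\<^sub>3 v * h (\<tau> - {v})))"
    unfolding lift nd pr
    by (simp add: r\<^sub>1_def r\<^sub>2_def r\<^sub>3_def algebra_simps power_add power_mult_distrib)
  finally have E: "\<epsilon> \<tau> c * E = x c ^ (m + (k + n)) * (r\<^sub>1 * f) + - (x c ^ (m + (k + n)) * (r\<^sub>2 * h \<sigma>))
     + x c ^ (k + n) * (r\<^sub>2 * (\<Sum>v\<in>\<sigma>. r\<^sub>3 v * h (\<tau> - {v})))" .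
  have P0: "P c 0 s = P a 0 s" for s using c P_base by auto
  have "P c (m + (k + n)) (\<epsilon> \<tau> c * E) = r\<^sub>1 - r\<^sub>2 * P a 0 (h \<sigma>) + r\<^sub>2 * (\<Sum>v\<in>\<sigma>. r\<^sub>3 v * P c m (h (\<tau> - {v})))"
    unfolding E P_add P_minus[OF c] P_shift[of c 0, simplified] P_shift[of c m "k + n"]
    using rR by (simp add: P_mult[OF c] P_mult[OF disjI1[OF refl]] P_sum[OF c] P0 P_f)
  also have "\<dots> = prod x \<sigma> ^ k * (prod x \<sigma> ^ m * (\<delta> * \<eta> \<sigma> * g \<sigma>)
     - prod x \<sigma> ^ n * (P a 0 (h \<sigma>) - num_diff x posV m (slice m h c) \<sigma>))"
  proof -
    have "(\<Sum>v\<in>\<sigma>. r\<^sub>3 v * P c m (h (\<tau> - {v}))) = num_diff x posV m (slice m h c) \<sigma>"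
      unfolding num_diff_def
    proof (rule sum.cong[OF refl])
      fix v assume "v \<in> \<sigma>"
      then have "insert c (\<sigma> - {v}) = \<tau> - {v}" using c\<sigma> by (auto simp: \<tau>_def)
      then show "r\<^sub>3 v * P c m (h (\<tau> - {v})) = \<epsilon> \<sigma> v * (x v ^ m * slice m h c (\<sigma> - {v}))"
        by (simp add: slice_def r\<^sub>3_def mult_ac)
    qed
    then show ?thesis by (simp add: r\<^sub>1_def r\<^sub>2_def algebra_simps power_add)
  qed
  finally have "P c (m + (k + n)) (\<epsilon> \<tau> c * E) = \<dots>" .
  moreover have "\<epsilon> \<tau> c * E \<in> J"
    using k sign_S by (intro big.mult_I) (auto simp: E_def \<tau>_def)
  ultimately show ?thesis using P_J[OF c] unfolding \<delta>_def by metis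
qed

text \<open>
  If the lifted cocycle were the coboundary of \<open>h\<close>, the difference of the two slice relations, in which
  \<open>h \<sigma>\<close> cancels, would make the original cocycle the coboundary of the difference of the slices.
\<close>

theorem has_class_suspension:
  assumes "has_class R K W x posW p"
  shows "has_class S J V x posV (Suc p)"
proof -
  obtain n g where "is_cocycle R K W x posW p n g" and no_cob: "\<not> is_coboundary R K W x posW p n g"
    using assms by (auto simp: has_class_def)
  then have g: "g \<sigma> \<in> R"
    and cocycle: "\<tau> \<subseteq> W \<Longrightarrow> card \<tau> = Suc p \<Longrightarrow> \<exists>k. prod x \<tau> ^ k * num_diff x posW n g \<tau> \<in> K"
    for \<sigma> \<tau> by (auto simp: is_cocycle_def)
  have "is_cocycle S J V x posV (Suc p) n (lift n g)"
    unfolding is_cocycle_def by (intro conjI allI impI lift_S g lift_cocycle[OF g cocycle]) auto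
  moreover have "is_coboundary R K W x posW p n g"
    if cob': "is_coboundary S J V x posV (Suc p) n (lift n g)"
  proof -
      obtain m h where h: "\<forall>\<sigma>. h \<sigma> \<in> S"
        and cob: "\<forall>\<sigma>. \<sigma> \<subseteq> V \<and> card \<sigma> = Suc p \<longrightarrow> (\<exists>k. prod x \<sigma> ^ k *
         (prod x \<sigma> ^ m * lift n g \<sigma> - prod x \<sigma> ^ n * num_diff x posV m h \<sigma>) \<in> J)"
        using cob' unfolding is_coboundary_def by blast
      define u where "u \<rho> = \<eta> \<rho> * (slice m h b \<rho> - slice m h a \<rho>)" for \<rho>
      have u: "u \<rho> \<in> R" for \<rho>
        using h by (auto simp: u_def slice_def intro!: sub.C_closed sign_R P_R)
      have "\<exists>k. prod x \<sigma> ^ k * (prod x \<sigma> ^ m * g \<sigma> - prod x \<sigma> ^ n * num_diff x posW m u \<sigma>) \<in> K"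
        if \<sigma>: "\<sigma> \<subseteq> W" "card \<sigma> = p" for \<sigma>
      proof -
        define X where "X = prod x \<sigma>"
        have fin: "finite \<sigma>" using finite_V V_split \<sigma> by (auto intro: finite_subset)
        have XR: "X \<in> R" using \<sigma> by (auto simp: X_def intro!: sub.prod_C x_R)
        have inj: "inj_on posW \<sigma>" "inj_on posV \<sigma>"
          using \<sigma> V_split by (auto intro: inj_on_subset[OF posW] inj_on_subset[OF posV])
        have ins: "insert c \<sigma> \<subseteq> V \<and> card (insert c \<sigma>) = Suc p" if "c = a \<or> c = b" for c
        proof -
          have "c \<in> V" "c \<notin> W" using that a b V_split by auto
          then show ?thesis using \<sigma> fin V_split by (subst card_insert_disjoint) auto
        qed
        define e\<^sub>a where "e\<^sub>a = X ^ m * (\<eta> \<sigma> * g \<sigma>) - X ^ n * (P a 0 (h \<sigma>) - num_diff x posV m (slice m h a) \<sigma>)"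
        define e\<^sub>b where "e\<^sub>b = - (X ^ n * (P a 0 (h \<sigma>) - num_diff x posV m (slice m h b) \<sigma>))"
        have ab: "a \<noteq> b" using a b V_split by auto
        obtain k where k: "X ^ k * e\<^sub>a \<in> K"
          using cob[rule_format, OF ins[of a]]
            slice_relation[where g = g and h = h and n = n and m = m and c = a, OF g _ _ \<sigma>(1) fin] h
          by (auto simp: e\<^sub>a_def X_def)
        obtain l where l: "X ^ l * e\<^sub>b \<in> K"
          using cob[rule_format, OF ins[of b]]
            slice_relation[where g = g and h = h and n = n and m = m and c = b, OF g _ _ \<sigma>(1) fin] h ab
          by (auto simp: e\<^sub>b_def X_def)
        have "\<eta> \<sigma> * (X ^ l * (X ^ k * e\<^sub>a) - X ^ k * (X ^ l * e\<^sub>b)) \<in> K"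
          by (intro sub.mult_I sub.diff_I sub.power_C XR k l sign_R)
        also have "\<eta> \<sigma> * (X ^ l * (X ^ k * e\<^sub>a) - X ^ k * (X ^ l * e\<^sub>b)) =
           X ^ (k + l) * (X ^ m * ((\<eta> \<sigma> * \<eta> \<sigma>) * g \<sigma>) - X ^ n *
             (\<eta> \<sigma> * (num_diff x posV m (slice m h b) \<sigma> - num_diff x posV m (slice m h a) \<sigma>)))"
          by (simp add: e\<^sub>a_def e\<^sub>b_def algebra_simps power_add)
        also have "\<eta> \<sigma> * (num_diff x posV m (slice m h b) \<sigma> - num_diff x posV m (slice m h a) \<sigma>)
          = num_diff x posW m u \<sigma>"
          unfolding num_diff_def sum_subtractf[symmetric] sum_distrib_left
        proof (rule sum.cong[OF refl])
          fix v assume v: "v \<in> \<sigma>"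
          have "order_sign posW \<sigma> v * \<eta> (\<sigma> - {v}) = (order_sign posW \<sigma> v * order_sign posW \<sigma> v) * (\<eta> \<sigma> * \<epsilon> \<sigma> v :: 'r)"
            unfolding inversion_sign_remove[OF fin inj v] by (simp add: mult_ac)
          then have s: "order_sign posW \<sigma> v * \<eta> (\<sigma> - {v}) = (\<eta> \<sigma> * \<epsilon> \<sigma> v :: 'r)"
            by (simp add: order_sign_square)
          have "order_sign posW \<sigma> v * (x v ^ m * u (\<sigma> - {v})) =
            (order_sign posW \<sigma> v * \<eta> (\<sigma> - {v})) * (x v ^ m * (slice m h b (\<sigma> - {v}) - slice m h a (\<sigma> - {v})))"
            by (simp add: u_def mult_ac)
          then show "\<eta> \<sigma> * (\<epsilon> \<sigma> v * (x v ^ m * slice m h b (\<sigma> - {v}))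
              - \<epsilon> \<sigma> v * (x v ^ m * slice m h a (\<sigma> - {v}))) =
            order_sign posW \<sigma> v * (x v ^ m * u (\<sigma> - {v}))"
            unfolding s by (simp add: algebra_simps)
        qed
        finally show ?thesis unfolding X_def by (auto simp: inversion_sign_square)
      qed
      then show ?thesis unfolding is_coboundary_def using u by (intro exI[of _ m] exI[of _ u]) simp
  qed
  ultimately show ?thesis using no_cob unfolding has_class_def by blast
qed

end

section \<open>Monomial ideals and powers of edge ideals\<close>

abbreviation keys :: "('a \<Rightarrow>\<^sub>0 'b::zero) \<Rightarrow> 'a set" where "keys \<equiv> Poly_Mapping.keys"
abbreviation lookup :: "('a \<Rightarrow>\<^sub>0 'b::zero) \<Rightarrow> 'a \<Rightarrow> 'b" where "lookup \<equiv> Poly_Mapping.lookup"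
abbreviation monomial :: "'a \<Rightarrow> 'b \<Rightarrow> 'a \<Rightarrow>\<^sub>0 'b::zero" where "monomial \<equiv> Poly_Mapping.single"
abbreviation dirac :: "'v \<Rightarrow> 'v \<Rightarrow>\<^sub>0 nat" where "dirac v \<equiv> Poly_Mapping.single v 1"

definition poly_set :: "'v set \<Rightarrow> ('v, 'k::comm_ring_1) mpolynomial set" where
  "poly_set V = {p. \<forall>m\<in>keys p. keys m \<subseteq> V}"

definition monomial_ideal ::
  "'v set \<Rightarrow> ('v \<Rightarrow>\<^sub>0 nat) set \<Rightarrow> ('v, 'k::comm_ring_1) mpolynomial set" where
  "monomial_ideal V M = {p \<in> poly_set V. keys p \<subseteq> M}"

lemma polynomial_ring_eq: "polynomial_ring V = subring_record (poly_set V)"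
  by (simp add: polynomial_ring_def subring_record_def poly_set_def)

lemma keys_add_nat: "keys (m + m') = keys m \<union> keys (m' :: 'a \<Rightarrow>\<^sub>0 nat)"
  by (auto simp: in_keys_iff lookup_add)

lemma keys_uminus: "keys (- p :: 'a \<Rightarrow>\<^sub>0 'b::ab_group_add) = keys p"
  by (auto simp: in_keys_iff)

lemma sum_monomials: "(p :: 'a \<Rightarrow>\<^sub>0 'b::comm_monoid_add) = (\<Sum>m\<in>keys p. monomial m (lookup p m))"
proof (rule poly_mapping_eqI)
  fix k
  have "(\<Sum>m\<in>keys p. lookup (monomial m (lookup p m)) k) = (\<Sum>m\<in>keys p. if k = m then lookup p m else 0)"
    by (intro sum.cong) (auto simp: lookup_single when_def)
  then show "lookup p k = lookup (\<Sum>m\<in>keys p. monomial m (lookup p m)) k"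
    by (simp add: lookup_sum in_keys_iff)
qed

lemma quotient_of_subring_monomial:
  assumes "\<And>m m'. m \<in> M \<Longrightarrow> m + m' \<in> M"
  shows "quotient_of_subring (poly_set V) (monomial_ideal V M :: ('v, 'k::comm_ring_1) mpolynomial set)"
proof
  have mult: "x * y \<in> poly_set V" if "x \<in> poly_set V" "y \<in> poly_set V"
    for x y :: "('v, 'k) mpolynomial"
    using that keys_mult[of x y] unfolding poly_set_def by (fastforce simp: keys_add_nat)
  show "x * y \<in> poly_set V" if "x \<in> poly_set V" "y \<in> poly_set V"
    for x y :: "('v, 'k) mpolynomial" using that by (rule mult)
  have add: "x + y \<in> poly_set V" if "x \<in> poly_set V" "y \<in> poly_set V"
    for x y :: "('v, 'k) mpolynomial"
    using that keys_add[of x y] unfolding poly_set_def by blast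
  show "x + y \<in> poly_set V" if "x \<in> poly_set V" "y \<in> poly_set V"
    for x y :: "('v, 'k) mpolynomial" using that by (rule add)
  show "x + y \<in> monomial_ideal V M" if "x \<in> monomial_ideal V M" "y \<in> monomial_ideal V M"
    for x y :: "('v, 'k) mpolynomial"
    using that keys_add[of x y] add unfolding monomial_ideal_def by blast
  show "c * x \<in> monomial_ideal V M" if "c \<in> poly_set V" "x \<in> monomial_ideal V M"
    for c x :: "('v, 'k) mpolynomial"
  proof -
    have "keys (c * x) \<subseteq> M"
      using keys_mult[of c x] that assms unfolding monomial_ideal_def
      by (auto simp: add.commute subset_iff) (metis add.commute)
    then show ?thesis using that mult unfolding monomial_ideal_def by blast
  qed
qed (auto simp: poly_set_def monomial_ideal_def keys_uminus)

lemma ring_polynomial_ring: "ring (polynomial_ring V :: ('v, 'k::comm_ring_1) mpolynomial ring)"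
proof -
  interpret quotient_of_subring "poly_set V" "monomial_ideal V {} :: ('v, 'k) mpolynomial set"
    by (rule quotient_of_subring_monomial) auto
  show ?thesis using cring_A unfolding polynomial_ring_eq cring_def by blast
qed

lemma ideal_monomial:
  assumes "\<And>m m'. m \<in> M \<Longrightarrow> m + m' \<in> M"
  shows "ideal (monomial_ideal V M :: ('v, 'k::comm_ring_1) mpolynomial set) (polynomial_ring V)"
proof -
  interpret quotient_of_subring "poly_set V" "monomial_ideal V M :: ('v, 'k) mpolynomial set"
    by (rule quotient_of_subring_monomial) (rule assms)
  interpret R: ring "polynomial_ring V :: ('v, 'k) mpolynomial ring" by (rule ring_polynomial_ring)
  have mult_I': "p * c \<in> monomial_ideal V M" if "p \<in> monomial_ideal V M" "c \<in> poly_set V"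
    for c p :: "('v, 'k) mpolynomial"
    using mult_I[OF that(2,1)] by (simp only: mult.commute)
  show ?thesis
  proof (rule idealI[OF R.ring_axioms])
    show "subgroup (monomial_ideal V M :: ('v, 'k) mpolynomial set) (add_monoid (polynomial_ring V))"
    proof (rule R.add.subgroupI)
      fix p :: "('v, 'k) mpolynomial" assume p: "p \<in> monomial_ideal V M"
      have "\<ominus>\<^bsub>polynomial_ring V\<^esub> p = - p"
        using p I_subset minus_C[of p]
        by (intro R.minus_equality) (auto simp: polynomial_ring_eq subring_record_def)
      then show "\<ominus>\<^bsub>polynomial_ring V\<^esub> p \<in> monomial_ideal V M"
        using minus_I[OF p] by simp
    qed (use I_subset zero_I add_I in \<open>auto simp: polynomial_ring_eq subring_record_def\<close>)
  qed (use mult_I mult_I' in \<open>auto simp: polynomial_ring_eq subring_record_def\<close>)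
qed

text \<open>
  A polynomial is the sum of its monomials, so an additively closed set contains a monomial ideal
  as soon as it contains the monomials.
\<close>

lemma monomial_ideal_subset_additive:
  fixes I :: "('v, 'k::comm_ring_1) mpolynomial set"
  assumes zero: "0 \<in> I" and add: "\<And>p q. p \<in> I \<Longrightarrow> q \<in> I \<Longrightarrow> p + q \<in> I"
    and mon: "\<And>m c. m \<in> M \<Longrightarrow> keys m \<subseteq> V \<Longrightarrow> monomial m c \<in> I"
  shows "monomial_ideal V M \<subseteq> I"
proof
  fix p :: "('v, 'k) mpolynomial" assume p: "p \<in> monomial_ideal V M"
  have "(\<Sum>m\<in>T. monomial m (lookup p m)) \<in> I" if "T \<subseteq> keys p" for T
    using finite_subset[OF that finite_keys] that
  proof (induction T rule: finite_induct)
    case (insert m T)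
    then show ?case using p mon by (auto simp: monomial_ideal_def poly_set_def intro!: add)
  qed (simp add: zero)
  then show "p \<in> I" using sum_monomials[of p] by (metis order_refl)
qed

text \<open>
  The exponent vectors of the multiples of products of \<open>s\<close> edges, with repetitions allowed.
\<close>

primrec edge_multiple :: "'v set set \<Rightarrow> nat \<Rightarrow> ('v \<Rightarrow>\<^sub>0 nat) \<Rightarrow> bool" where
  "edge_multiple E 0 m \<longleftrightarrow> True"
| "edge_multiple E (Suc s) m \<longleftrightarrow>
     (\<exists>u v m'. {u, v} \<in> E \<and> m = dirac u + dirac v + m' \<and> edge_multiple E s m')"

lemma edge_multiple_add: "edge_multiple E s m \<Longrightarrow> edge_multiple E s (m + m')"
proof (induction s arbitrary: m)
  case (Suc s)
  then obtain u v n where n: "{u, v} \<in> E" "m = dirac u + dirac v + n" "edge_multiple E s n" by auto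
  then have "m + m' = dirac u + dirac v + (n + m')" by (simp add: add.assoc)
  then show ?case using n Suc.IH by auto
qed simp

lemma edge_multiple_edge_add:
  "{u, v} \<in> E \<Longrightarrow> edge_multiple E s m \<Longrightarrow> edge_multiple E (Suc s) (dirac u + dirac v + m)"
  by auto

lemma edge_multiple_plus:
  "edge_multiple E s m \<Longrightarrow> edge_multiple E r n \<Longrightarrow> edge_multiple E (s + r) (m + n)"
proof (induction s arbitrary: m)
  case 0
  then show ?case using edge_multiple_add[of E r n m] by (simp add: add.commute)
next
  case (Suc s)
  then obtain u v k where k: "{u, v} \<in> E" "m = dirac u + dirac v + k" "edge_multiple E s k" by auto
  then show ?case using edge_multiple_edge_add[OF k(1) Suc.IH[OF k(3) Suc.prems(2)]]
    by (simp add: add.assoc)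
qed

lemma variable_mult_single: "variable u * variable v * monomial m c = monomial (dirac u + dirac v + m) c"
  by (simp add: variable_def mult_single)

lemma edge_multiple_one_iff:
  "edge_multiple E 1 m \<longleftrightarrow> (\<exists>u v m'. {u, v} \<in> E \<and> m = dirac u + dirac v + m')"
  by simp

lemma edge_multiple_mono: "E \<subseteq> E' \<Longrightarrow> edge_multiple E s m \<Longrightarrow> edge_multiple E' s m"
proof (induction s arbitrary: m)
  case (Suc s)
  then obtain u v n where n: "{u, v} \<in> E" "m = dirac u + dirac v + n" "edge_multiple E s n" by auto
  then have "{u, v} \<in> E'" "edge_multiple E' s n" using Suc by auto
  then show ?case unfolding n(2) by (rule edge_multiple_edge_add)
qed simp

declare edge_multiple.simps(2) [simp del]

lemma edge_ideal_eq:
  assumes "finite_simple_graph G"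
  shows "(edge_ideal G :: ('v, 'k::comm_ring_1) mpolynomial set)
    = monomial_ideal (verts G) {m. edge_multiple (edges G) 1 m}"
proof
  let ?A = "polynomial_ring (verts G) :: ('v, 'k) mpolynomial ring"
  let ?M = "monomial_ideal (verts G) {m. edge_multiple (edges G) 1 m} :: ('v, 'k) mpolynomial set"
  let ?gens = "{variable u * variable v | u v. {u, v} \<in> edges G} :: ('v, 'k) mpolynomial set"
  interpret A: ring ?A by (rule ring_polynomial_ring)
  have var2: "variable u * variable v = (monomial (dirac u + dirac v) 1 :: ('v, 'k) mpolynomial)" for u v
    by (simp add: variable_def mult_single)
  have gens: "?gens \<subseteq> ?M"
  proof clarify
    fix u v assume uv: "{u, v} \<in> edges G"
    then have "edge_multiple (edges G) 1 (dirac u + dirac v + 0)" unfolding edge_multiple_one_iff by blast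
    moreover have "{u, v} \<subseteq> verts G" using assms uv by (auto simp: finite_simple_graph_def)
    ultimately show "variable u * variable v \<in> ?M"
      unfolding var2 by (auto simp: monomial_ideal_def poly_set_def keys_add_nat)
  qed
  have sub: "?gens \<subseteq> carrier ?A"
    using gens by (auto simp: polynomial_ring_eq subring_record_def monomial_ideal_def)
  have "ideal ?M ?A" by (intro ideal_monomial) (auto intro: edge_multiple_add)
  then show "edge_ideal G \<subseteq> ?M" unfolding edge_ideal_def using gens by (intro A.genideal_minimal)
  interpret I: ideal "edge_ideal G" ?A unfolding edge_ideal_def by (rule A.genideal_ideal[OF sub])
  show "?M \<subseteq> edge_ideal G"
  proof (rule monomial_ideal_subset_additive)
    show "0 \<in> (edge_ideal G :: ('v, 'k) mpolynomial set)"
      using I.zero_closed by (simp add: polynomial_ring_def)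
    show "p + q \<in> edge_ideal G" if "p \<in> edge_ideal G" "q \<in> edge_ideal G"
      for p q :: "('v, 'k) mpolynomial"
      using I.a_closed[OF that] by (simp add: polynomial_ring_def)
    fix m c assume "m \<in> {m. edge_multiple (edges G) 1 m}" and mV: "keys m \<subseteq> verts G"
    then obtain u v m' where m: "{u, v} \<in> edges G" "m = dirac u + dirac v + m'"
      unfolding edge_multiple_one_iff by blast
    have "variable u * variable v \<in> (edge_ideal G :: ('v, 'k) mpolynomial set)"
      unfolding edge_ideal_def using m(1) by (intro subsetD[OF A.genideal_self[OF sub]]) blast
    moreover have "monomial m' c \<in> carrier ?A"
      using mV by (auto simp: polynomial_ring_eq subring_record_def poly_set_def m(2) keys_add_nat)
    ultimately have "variable u * variable v * monomial m' c \<in> (edge_ideal G :: ('v, 'k) mpolynomial set)"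
      using I.I_r_closed by (fastforce simp: polynomial_ring_def)
    then show "monomial m c \<in> (edge_ideal G :: ('v, 'k) mpolynomial set)"
      by (simp add: m(2) variable_mult_single)
  qed
qed

text \<open>
  All questions about membership in powers of an edge ideal become questions about exponent
  vectors.
\<close>

lemma edge_ideal_power_eq:
  fixes G :: "'v graph"
  assumes "finite_simple_graph G"
  shows "(edge_ideal G :: ('v, 'k::comm_ring_1) mpolynomial set) [^]\<^bsub>ideals_set (polynomial_ring (verts G))\<^esub> s
    = monomial_ideal (verts G) {m. edge_multiple (edges G) s m}"
proof (induction s)
  case 0
  show ?case
    by (simp add: nat_pow_def ideals_set_def polynomial_ring_eq subring_record_def monomial_ideal_def)
next
  case (Suc s)
  let ?A = "polynomial_ring (verts G) :: ('v, 'k) mpolynomial ring"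
  let ?M = "\<lambda>s. monomial_ideal (verts G) {m. edge_multiple (edges G) s m} :: ('v, 'k) mpolynomial set"
  have qs: "quotient_of_subring (poly_set (verts G)) (?M s)" for s
    by (rule quotient_of_subring_monomial) (auto intro: edge_multiple_add)
  have "(edge_ideal G :: ('v, 'k) mpolynomial set) [^]\<^bsub>ideals_set ?A\<^esub> Suc s
     = ideal_prod ?A (edge_ideal G [^]\<^bsub>ideals_set ?A\<^esub> s) (edge_ideal G)"
    by (simp add: nat_pow_def ideals_set_def)
  also have "\<dots> = ideal_prod ?A (?M s) (?M 1)"
    unfolding Suc.IH by (simp only: edge_ideal_eq[OF assms])
  also have "\<dots> = ?M (Suc s)"
  proof
    show "ideal_prod ?A (?M s) (?M 1) \<subseteq> ?M (Suc s)"
    proof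
      fix p assume "p \<in> ideal_prod ?A (?M s) (?M 1)"
      then show "p \<in> ?M (Suc s)"
      proof (induction p rule: ideal_prod.induct)
        case (prod i j)
        have "i * j \<in> poly_set (verts G)"
          using prod by (intro quotient_of_subring.mult_C[OF qs]) (auto simp: monomial_ideal_def)
        moreover have "edge_multiple (edges G) (s + 1) m" if m: "m \<in> keys (i * j)" for m
        proof -
          obtain m1 m2 where "m1 \<in> keys i" "m2 \<in> keys j" "m = m1 + m2"
            using m keys_mult[of i j] by blast
          then show ?thesis
            using prod edge_multiple_plus[of "edges G" s m1 1 m2] unfolding monomial_ideal_def by blast
        qed
        ultimately show ?case
          by (auto simp: monomial_ideal_def polynomial_ring_def)
      next
        case (sum s1 s2)
        then show ?case using quotient_of_subring.add_I[OF qs] by (simp add: polynomial_ring_def)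
      qed
    qed
    show "?M (Suc s) \<subseteq> ideal_prod ?A (?M s) (?M 1)"
    proof (rule monomial_ideal_subset_additive)
      have "0 \<otimes>\<^bsub>?A\<^esub> 0 \<in> ideal_prod ?A (?M s) (?M 1)"
        by (intro ideal_prod.prod quotient_of_subring.zero_I[OF qs])
      then show "0 \<in> ideal_prod ?A (?M s) (?M 1)" by (simp add: polynomial_ring_def)
      show "p + q \<in> ideal_prod ?A (?M s) (?M 1)"
        if "p \<in> ideal_prod ?A (?M s) (?M 1)" "q \<in> ideal_prod ?A (?M s) (?M 1)" for p q
        using ideal_prod.sum[OF that] by (simp add: polynomial_ring_def)
      fix m c assume "m \<in> {m. edge_multiple (edges G) (Suc s) m}" and mV: "keys m \<subseteq> verts G"
      then obtain u v m' where m: "{u, v} \<in> edges G" "m = dirac u + dirac v + m'" "edge_multiple (edges G) s m'"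
        by (auto simp: edge_multiple.simps)
      have "monomial m' c \<otimes>\<^bsub>?A\<^esub> monomial (dirac u + dirac v) 1 \<in> ideal_prod ?A (?M s) (?M 1)"
      proof (rule ideal_prod.prod)
        show "monomial m' c \<in> ?M s"
          using m mV by (auto simp: monomial_ideal_def poly_set_def keys_add_nat)
        have "edge_multiple (edges G) 1 (dirac u + dirac v + 0)"
          using m(1) unfolding edge_multiple_one_iff by blast
        then show "monomial (dirac u + dirac v) 1 \<in> ?M 1"
          using m mV by (auto simp: monomial_ideal_def poly_set_def keys_add_nat)
      qed
      then show "monomial m c \<in> ideal_prod ?A (?M s) (?M 1)"
        by (simp add: polynomial_ring_def mult_single m(2) add.commute)
    qed
  qed
  finally show ?case .
qed

section \<open>Extracting coefficients\<close>

text \<open>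
  The coefficient of the monomial with exponent \<open>c\<close> when \<open>p\<close> is regarded as a polynomial in the variables
  outside \<open>W\<close> over the polynomial ring in the variables of \<open>W\<close>; this reading supposes that \<open>c\<close> has no
  variable in \<open>W\<close>.
\<close>

definition coeff_at :: "'v set \<Rightarrow> ('v \<Rightarrow>\<^sub>0 nat) \<Rightarrow> ('v, 'k::comm_ring_1) mpolynomial \<Rightarrow> ('v, 'k) mpolynomial" where
  "coeff_at W c p = Abs_poly_mapping (\<lambda>m. lookup p (m + c) when keys m \<subseteq> W)"

lemma lookup_coeff_at: "lookup (coeff_at W c p) m = (lookup p (m + c) when keys m \<subseteq> W)"
proof -
  have "finite {m. (lookup p (m + c) when keys m \<subseteq> W) \<noteq> 0}"
    by (rule finite_surj[OF finite_keys, of _ "\<lambda>k. k - c" p])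
      (auto simp: in_keys_iff intro!: image_eqI[of _ _ "m + c" for m])
  then show ?thesis by (simp add: coeff_at_def)
qed

lemma coeff_at_poly_set: "coeff_at W c p \<in> poly_set W"
  by (auto simp: poly_set_def in_keys_iff lookup_coeff_at)

lemma coeff_at_add: "coeff_at W c (p + q) = coeff_at W c p + coeff_at W c q"
  by (rule poly_mapping_eqI) (simp add: lookup_coeff_at lookup_add when_add_distrib)

lemma coeff_at_sum: "coeff_at W c (sum p T) = (\<Sum>i\<in>T. coeff_at W c (p i))"
proof -
  have "coeff_at W c 0 = 0" by (rule poly_mapping_eqI) (simp add: lookup_coeff_at)
  then show ?thesis by (induction T rule: infinite_finite_induct) (simp_all add: coeff_at_add)
qed

lemma lookup_single_mult:
  fixes d :: "'v \<Rightarrow>\<^sub>0 nat"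
  shows "lookup (monomial d \<alpha> * p) (d + k) = \<alpha> * lookup p k"
    and "\<nexists>k. n = d + k \<Longrightarrow> lookup (monomial d \<alpha> * p) n = 0"
proof -
  have *: "lookup (monomial d \<alpha> * p) n = \<alpha> * (\<Sum>q. lookup p q when n = d + q)" for n
    by (simp add: lookup_mult lookup_single when_mult)
  show "lookup (monomial d \<alpha> * p) (d + k) = \<alpha> * lookup p k"
    by (simp add: *)
  show "lookup (monomial d \<alpha> * p) n = 0" if "\<nexists>k. n = d + k"
  proof -
    have "(lookup p q when n = d + q) = 0" for q using that by (auto simp: when_def)
    then show ?thesis by (simp add: *)
  qed
qed

lemma coeff_at_shift: "coeff_at W (c + d) (monomial d 1 * p) = coeff_at W c p"
proof (rule poly_mapping_eqI)
  fix m
  have "m + (c + d) = d + (m + c)" by (simp add: add_ac)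
  then show "lookup (coeff_at W (c + d) (monomial d 1 * p)) m = lookup (coeff_at W c p) m"
    by (simp add: lookup_coeff_at lookup_single_mult(1))
qed

text \<open>
  Linearity over the smaller polynomial ring, checked on monomials: as \<open>c\<close> has no variable in \<open>W\<close>, a
  monomial \<open>d\<close> in the variables of \<open>W\<close> divides \<open>m + c\<close> only if it divides \<open>m\<close>.
\<close>

lemma coeff_at_mult:
  fixes p :: "('v, 'k::comm_ring_1) mpolynomial"
  assumes r: "r \<in> poly_set W" and c: "keys c \<inter> W = {}"
  shows "coeff_at W c (r * p) = r * coeff_at W c p"
proof -
  have single: "coeff_at W c (monomial d \<alpha> * p) = monomial d \<alpha> * coeff_at W c p" if d: "keys d \<subseteq> W" for d \<alpha>
  proof (rule poly_mapping_eqI)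
    fix m
    show "lookup (coeff_at W c (monomial d \<alpha> * p)) m = lookup (monomial d \<alpha> * coeff_at W c p) m"
    proof (cases "\<exists>k. m = d + k")
      case True
      then obtain k where k: "m = d + k" by blast
      have "lookup (monomial d \<alpha> * p) (m + c) = \<alpha> * lookup p (k + c)"
        using lookup_single_mult(1)[of d \<alpha> p "k + c"] by (simp add: k add.assoc)
      then show ?thesis using d
        by (simp add: k lookup_single_mult(1) lookup_coeff_at keys_add_nat) (simp add: when_def)
    next
      case False
      have "\<nexists>k. m + c = d + k"
      proof
        assume "\<exists>k. m + c = d + k"
        then obtain k where k: "m + c = d + k" by blast
        have le: "lookup d v \<le> lookup m v" for v
        proof (cases "v \<in> keys d")
          case True
          then have "v \<notin> keys c" using c d by blast
          then have "lookup c v = 0" by (simp add: in_keys_iff)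
          moreover have "lookup m v + lookup c v = lookup d v + lookup k v"
            using k by (metis lookup_add)
          ultimately show ?thesis by simp
        qed (simp add: in_keys_iff)
        have "m = d + (m - d)"
          using le by (intro poly_mapping_eqI) (simp add: lookup_add lookup_minus)
        then show False using False by blast
      qed
      then show ?thesis using False by (simp add: lookup_single_mult(2) lookup_coeff_at)
    qed
  qed
  have "coeff_at W c (r * p) = coeff_at W c (\<Sum>d\<in>keys r. monomial d (lookup r d) * p)"
    by (subst sum_monomials[of r]) (simp add: sum_distrib_right)
  also have "\<dots> = (\<Sum>d\<in>keys r. monomial d (lookup r d) * coeff_at W c p)"
    unfolding coeff_at_sum using r by (intro sum.cong refl single) (auto simp: poly_set_def)
  also have "\<dots> = r * coeff_at W c p"
    by (subst (3) sum_monomials[of r]) (simp add: sum_distrib_right)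
  finally show ?thesis .
qed

lemma coeff_at_self: "coeff_at W c (monomial c 1) = 1"
proof (rule poly_mapping_eqI)
  fix m
  have "c = m + c \<longleftrightarrow> m = 0" by (metis add_0 add_right_cancel)
  then show "lookup (coeff_at W c (monomial c 1)) m = lookup 1 m"
    by (auto simp: lookup_coeff_at lookup_single lookup_one when_def)
qed

lemma variable_power: "variable v ^ n = monomial (monomial v n) (1 :: 'k::comm_ring_1)"
proof (induction n)
  case (Suc n)
  then show ?case by (simp add: variable_def mult_single flip: single_add)
qed (simp add: single_zero)

section \<open>Depth over a polynomial ring\<close>

text \<open>
  The enumeration of the variables that is chosen in the definition of the depth survives only as an
  injective numbering \<open>pos\<close> of the variables.
\<close>

lemma polynomial_depth_has_class:
  fixes I :: "('v, 'k::comm_ring_1) mpolynomial set"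
  assumes "finite V" and I: "quotient_of_subring (poly_set V) I"
  obtains pos where "inj_on pos V"
    and "polynomial_depth V (quotient_module (regular_module (polynomial_ring V)) I)
      = Inf {enat i | i. has_class (poly_set V) I V variable pos i}"
proof -
  define vs where "vs = (SOME vs. distinct vs \<and> set vs = V)"
  have vs: "distinct vs" "set vs = V"
    using someI_ex[OF finite_distinct_list[OF assms(1), unfolded conj_commute[of "set _ = _"]]]
    by (auto simp: vs_def)
  define pos where "pos = inv_into {..<length vs} ((!) vs)"
  have bij: "bij_betw ((!) vs) {..<length vs} V"
    using bij_betw_nth[OF vs(1) refl] vs(2) by simp
  have nth_pos: "vs ! pos v = v" "pos v < length vs" if "v \<in> V" for v
    using bij that f_inv_into_f[of v "(!) vs" "{..<length vs}"] inv_into_into[of v "(!) vs" "{..<length vs}"]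
    by (auto simp: bij_betw_def pos_def)
  have pos_nth: "pos (vs ! i) = i" if "i < length vs" for i
    using bij that inv_into_f_f[of "(!) vs" "{..<length vs}" i] by (auto simp: bij_betw_def pos_def)
  have bij_pos: "inj_on pos V" "pos ` V = {..<length vs}"
    using bij_betw_inv_into[OF bij] by (auto simp: bij_betw_def pos_def)
  interpret cech_of_quotient "poly_set V" I "map variable vs"
    using I vs(2) by (intro cech_of_quotient.intro cech_of_quotient_axioms.intro)
      (auto simp: poly_set_def variable_def)
  have "has_class (poly_set V) I {..<length vs} ((!) (map variable vs)) (\<lambda>i. i) i
    \<longleftrightarrow> has_class (poly_set V) I V variable pos i" for i
  proof
    assume "has_class (poly_set V) I {..<length vs} ((!) (map variable vs)) (\<lambda>i. i) i"
    then show "has_class (poly_set V) I V variable pos i"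
      by (rule has_class_reindex[OF bij_pos, rotated 2]) (simp_all add: nth_pos)
  next
    assume "has_class (poly_set V) I V variable pos i"
    then show "has_class (poly_set V) I {..<length vs} ((!) (map variable vs)) (\<lambda>i. i) i"
      using bij by (intro has_class_reindex[of "(!) vs" "{..<length vs}" V]) (simp_all add: bij_betw_def pos_nth)
  qed
  then have "polynomial_depth V (quotient_module (regular_module (polynomial_ring V)) I)
      = Inf {enat i | i. has_class (poly_set V) I V variable pos i}"
    unfolding polynomial_depth_def depth_def vs_def[symmetric] polynomial_ring_eq
      cohomology_nontrivial_iff_has_class by simp
  then show thesis using that bij_pos(1) by blast
qed

section \<open>Edges and degrees\<close>

definition edge_exponent :: "'v set set \<Rightarrow> 'v \<Rightarrow>\<^sub>0 nat" where
  "edge_exponent es = (\<Sum>e\<in>es. \<Sum>v\<in>e. dirac v)"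

lemma edge_exponent_remove:
  assumes "finite es" "{u, v} \<in> es" "u \<noteq> v"
  shows "edge_exponent es = dirac u + dirac v + edge_exponent (es - {{u, v}})"
  using assms by (simp add: edge_exponent_def sum.remove[of es "{u, v}"])

lemma keys_edge_exponent: "keys (edge_exponent es) \<subseteq> \<Union>es"
  for es :: "'v set set"
proof -
  have keys_sum: "keys (sum f T) \<subseteq> (\<Union>i\<in>T. keys (f i))" for T and f :: "'b \<Rightarrow> 'v \<Rightarrow>\<^sub>0 nat"
    by (induction T rule: infinite_finite_induct) (auto simp: keys_add_nat)
  have "keys (\<Sum>v\<in>e. dirac v) \<subseteq> e" for e :: "'v set"
    using keys_sum[of dirac e] by simp
  then show ?thesis
    unfolding edge_exponent_def using keys_sum[of "\<lambda>e. \<Sum>v\<in>e. dirac v" es] by blast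
qed

lemma edge_multiple_edge_exponent:
  assumes "finite es" "\<forall>e\<in>es. card e = 2" "es \<subseteq> E"
  shows "edge_multiple E (card es) (edge_exponent es)"
  using assms
proof (induction es rule: finite_induct)
  case (insert e es)
  obtain u v where e: "e = {u, v}" "u \<noteq> v"
    using insert.prems(1) by (auto simp: card_2_iff)
  have "edge_exponent (insert e es) = dirac u + dirac v + edge_exponent es"
    using insert.hyps e by (simp add: edge_exponent_def)
  then show ?case
    using insert e edge_multiple_edge_add[of u v E "card es" "edge_exponent es"]
    by simp
qed simp

text \<open>
  If each of the \<open>s\<close> edges meets \<open>T\<close>, then each contributes at least one to the degree in \<open>T\<close>.
\<close>

lemma edge_multiple_degree:
  assumes "finite T" "edge_multiple E s m"
  shows "s \<le> (\<Sum>v\<in>T. lookup m v) \<or> (\<exists>e\<in>E. e \<subseteq> keys m \<and> e \<inter> T = {})"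
  using assms(2)
proof (induction s arbitrary: m)
  case (Suc s)
  then obtain u v n where n: "{u, v} \<in> E" "m = dirac u + dirac v + n" "edge_multiple E s n"
    by (auto simp: edge_multiple.simps)
  consider "s \<le> (\<Sum>v\<in>T. lookup n v)" "u \<in> T \<or> v \<in> T"
    | "{u, v} \<inter> T = {}" | e where "e \<in> E" "e \<subseteq> keys n" "e \<inter> T = {}"
    using Suc.IH[OF n(3)] by blast
  then show ?case
  proof cases
    case 1
    have deg: "(\<Sum>w\<in>T. lookup (dirac x) w) = (if x \<in> T then 1 else 0)" for x
      using assms(1) by (simp add: lookup_single when_def)
    have "(\<Sum>w\<in>T. lookup m w) = (if u \<in> T then 1 else 0) + (if v \<in> T then 1 else 0) + (\<Sum>w\<in>T. lookup n w)"
      unfolding n(2) lookup_add sum.distrib deg ..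
    then show ?thesis using 1 by auto
  next
    case 2
    then show ?thesis using n by (auto simp: keys_add_nat)
  next
    case 3
    then show ?thesis using n by (auto simp: keys_add_nat)
  qed
qed simp

lemma degree_edge_exponent:
  assumes "finite es" "finite T" and cross: "\<And>e. e \<in> es \<Longrightarrow> finite e \<and> card (e \<inter> T) = 1"
  shows "(\<Sum>v\<in>T. lookup (edge_exponent es) v) = card es"
proof -
  have "(\<Sum>v\<in>T. lookup (edge_exponent es) v) = (\<Sum>e\<in>es. \<Sum>v\<in>T. lookup (\<Sum>u\<in>e. dirac u) v)"
    unfolding edge_exponent_def lookup_sum by (rule sum.swap)
  also have "\<dots> = (\<Sum>e\<in>es. 1)"
  proof (rule sum.cong[OF refl])
    fix e assume e: "e \<in> es"
    have "lookup (\<Sum>u\<in>e. dirac u) v = (if v \<in> e then 1 else 0)" for v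
      using cross[OF e] by (simp add: lookup_sum lookup_single when_def)
    then have "(\<Sum>v\<in>T. lookup (\<Sum>u\<in>e. dirac u) v) = card (e \<inter> T)"
      using assms(2) by (simp add: sum.If_cases Int_def conj_commute)
    then show "(\<Sum>v\<in>T. lookup (\<Sum>u\<in>e. dirac u) v) = 1" using cross[OF e] by simp
  qed
  finally show ?thesis by simp
qed

lemma rtrancl_path_avoid:
  assumes "rtrancl_path (\<lambda>a b. {a, b} \<in> es) w ws y" "x \<notin> set (w # ws)"
  shows "rtrancl_path (\<lambda>a b. {a, b} \<in> es - {{x, z}}) w ws y"
  using assms
proof (induction rule: rtrancl_path.induct)
  case (step v w ws y)
  then have "{v, w} \<noteq> {x, z}" by auto
  then show ?case using step by (intro rtrancl_path.step) auto
qed (rule rtrancl_path.base)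

text \<open>
  Let \<open>x, z, w, \<dots>, y\<close> be the path. The factor \<open>x z\<close> of the product of \<open>es\<close> is split to form the edge \<open>p x\<close>,
  which leaves \<open>z\<close> in the role of \<open>p\<close> for the rest of the path, from \<open>w\<close> to \<open>y\<close>. The path stays in
  the remaining edges because it does not return to \<open>x\<close>. At the end \<open>z = y\<close>, and \<open>y q\<close> is the additional
  edge.
\<close>

lemma alternating_path_exchange:
  assumes "rtrancl_path (\<lambda>a b. {a, b} \<in> es) x xs y" "distinct (x # xs)"
    and "finite es" "es \<subseteq> E" "\<And>e. e \<in> es \<Longrightarrow> \<exists>a\<in>A. \<exists>b\<in>B. e = {a, b}" "A \<inter> B = {}"
    and "x \<in> B" "y \<in> A" "{p, x} \<in> E" "{y, q} \<in> E"
  shows "edge_multiple E (Suc (card es)) (dirac p + dirac q + edge_exponent es)"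
  using assms
proof (induction "length xs" arbitrary: es p x xs rule: less_induct)
  case less
  have "x \<noteq> y" using less.prems by auto
  then obtain z zs where xs: "xs = z # zs" and xz: "{x, z} \<in> es"
    and path: "rtrancl_path (\<lambda>a b. {a, b} \<in> es) z zs y"
    using less.prems(1) by (auto elim: rtrancl_path.cases)
  define es' where "es' = es - {{x, z}}"
  have side: "v \<in> A" if "{u, v} \<in> es" "u \<in> B" for u v
    using less.prems(5)[OF that(1)] less.prems(6) that(2) by (auto simp: doubleton_eq_iff)
  have side': "v \<in> B" if "{u, v} \<in> es" "u \<in> A" for u v
    using less.prems(5)[OF that(1)] less.prems(6) that(2) by (auto simp: doubleton_eq_iff)
  have z: "z \<in> A" using side xz less.prems(7) by blast
  have F: "edge_exponent es = dirac x + dirac z + edge_exponent es'"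
    unfolding es'_def using less.prems(2,3) xz xs by (intro edge_exponent_remove) auto
  have card: "card es = Suc (card es')"
    unfolding es'_def using less.prems(3) xz by (rule card.remove)
  have "edge_multiple E (Suc (card es')) (dirac z + dirac q + edge_exponent es')"
  proof (cases zs)
    case Nil
    then have "z = y" using path by (auto elim: rtrancl_path.cases)
    moreover have "edge_multiple E (card es') (edge_exponent es')"
    proof (intro edge_multiple_edge_exponent ballI)
      fix e assume "e \<in> es'"
      then obtain c d where "c \<in> A" "d \<in> B" "e = {c, d}"
        using less.prems(5) unfolding es'_def by blast
      moreover from this have "c \<noteq> d" using less.prems(6) by blast
      ultimately show "card e = 2" by simp
    qed (use less.prems(3,4) in \<open>auto simp: es'_def\<close>)
    ultimately show ?thesis using less.prems(10) edge_multiple_edge_add by metis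
  next
    case (Cons w ws)
    then have zw: "{z, w} \<in> es" and path': "rtrancl_path (\<lambda>a b. {a, b} \<in> es) w ws y"
      using path by (auto elim: rtrancl_path.cases)
    show ?thesis
    proof (rule less.hyps)
      show "rtrancl_path (\<lambda>a b. {a, b} \<in> es') w ws y"
        unfolding es'_def using less.prems(2) xs Cons by (intro rtrancl_path_avoid path') auto
      show "length ws < length xs" "distinct (w # ws)" using less.prems(2) xs Cons by auto
      show "finite es'" "es' \<subseteq> E" using less.prems(3,4) by (auto simp: es'_def)
      show "w \<in> B" using side' zw z by blast
      show "{z, w} \<in> E" using zw less.prems(4) by blast
      show "\<exists>a\<in>A. \<exists>b\<in>B. e = {a, b}" if "e \<in> es'" for e
        using that less.prems(5) unfolding es'_def by blast
    qed (fact less.prems)+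
  qed
  then have "edge_multiple E (Suc (Suc (card es'))) (dirac p + dirac x + (dirac z + dirac q + edge_exponent es'))"
    by (rule edge_multiple_edge_add[OF less.prems(9)])
  then show ?case unfolding F card by (simp add: add_ac)
qed

locale bipartite_edge_set =
  fixes G :: "'v graph" and es :: "'v set set" and A B :: "'v set"
  assumes G: "finite_simple_graph G" and es: "es \<subseteq> edges G" and es_ne: "es \<noteq> {}"
    and AB: "A \<union> B = closed_nbhd_edges G es" "A \<inter> B = {}"
    and bip: "\<And>e. e \<in> edges G \<Longrightarrow> e \<subseteq> closed_nbhd_edges G es \<Longrightarrow> \<exists>a\<in>A. \<exists>b\<in>B. e = {a, b}"
    and conn: "connected_graph (edge_subgraph es)"
begin

abbreviation N where "N \<equiv> closed_nbhd_edges G es"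
abbreviation H where "H \<equiv> induced_subgraph G (verts G - N)"

lemma sides_swapped: "bipartite_edge_set G es B A"
proof
  show "\<exists>a\<in>B. \<exists>b\<in>A. e = {a, b}" if "e \<in> edges G" "e \<subseteq> N" for e
  proof -
    obtain a b where "a \<in> A" "b \<in> B" "e = {a, b}" using bip[OF \<open>e \<in> edges G\<close> \<open>e \<subseteq> N\<close>] by blast
    then show ?thesis by (intro bexI[of _ b] bexI[of _ a]) (simp_all add: insert_commute)
  qed
qed (use G es es_ne AB conn in auto)

lemma finite_es: "finite es"
proof -
  have "es \<subseteq> Pow (verts G)" using G es by (auto simp: finite_simple_graph_def)
  moreover have "finite (verts G)" using G by (simp add: finite_simple_graph_def)
  ultimately show ?thesis by (meson finite_Pow_iff finite_subset)
qed

lemma edge_verts: "{u, v} \<in> edges G \<Longrightarrow> u \<in> verts G \<and> v \<in> verts G"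
  using G unfolding finite_simple_graph_def by blast

lemma Union_es_N: "\<Union>es \<subseteq> N"
  by (auto simp: closed_nbhd_edges_def closed_nbhd_def)

lemma N_verts: "N \<subseteq> verts G"
proof
  fix v assume "v \<in> N"
  then obtain u where u: "u \<in> \<Union>es" "v = u \<or> {u, v} \<in> edges G"
    by (auto simp: closed_nbhd_edges_def closed_nbhd_def)
  moreover have "u \<in> verts G" using u(1) es G unfolding finite_simple_graph_def by blast
  ultimately show "v \<in> verts G" using edge_verts by blast
qed

lemma es_cross: "e \<in> es \<Longrightarrow> \<exists>a\<in>A. \<exists>b\<in>B. e = {a, b}"
  using bip[of e] es Union_es_N by blast

lemma nbhd: "u \<in> \<Union>es \<Longrightarrow> {u, v} \<in> edges G \<Longrightarrow> v \<in> N"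
  by (auto simp: closed_nbhd_edges_def closed_nbhd_def)

lemma adjacent_to_es:
  assumes "p \<in> A"
  shows "\<exists>x\<in>\<Union>es \<inter> B. {p, x} \<in> edges G"
proof -
  have "\<exists>x\<in>\<Union>es. {p, x} \<in> edges G"
  proof (cases "p \<in> \<Union>es")
    case True
    then obtain e where e: "e \<in> es" "p \<in> e" by blast
    then obtain a b where "e = {a, b}" using es_cross by blast
    then have "{a, b} \<in> edges G" "{b, a} \<in> edges G" "a \<in> \<Union>es" "b \<in> \<Union>es"
      using e es by (auto simp: insert_commute)
    then show ?thesis using e \<open>e = {a, b}\<close> by blast
  next
    case False
    then show ?thesis using assms AB(1) by (fastforce simp: closed_nbhd_edges_def closed_nbhd_def insert_commute)
  qed
  then obtain x where x: "x \<in> \<Union>es" "{p, x} \<in> edges G" by blast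
  then have "{p, x} \<subseteq> N" using assms AB Union_es_N by blast
  then have "x \<in> B" using bip[OF x(2)] assms AB(2) by (auto simp: doubleton_eq_iff)
  then show ?thesis using x by blast
qed

lemma exists_endpoint: "\<exists>a\<in>A. a \<in> \<Union>es"
  using es_ne es_cross by blast

text \<open>
  The endpoints \<open>x\<close> and \<open>y\<close> are chosen in \<open>es\<close> next to \<open>p\<close> and \<open>q\<close>, so they lie in opposite parts of the
  bipartition, and connectedness of \<open>es\<close> provides the path to be exchanged.
\<close>

lemma edge_multiple_cross:
  assumes "p \<in> A" "q \<in> B"
  shows "edge_multiple (edges G) (Suc (card es)) (dirac p + dirac q + edge_exponent es)"
proof -
  obtain x where x: "x \<in> \<Union>es" "x \<in> B" "{p, x} \<in> edges G" using adjacent_to_es[OF assms(1)] by blast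
  obtain y where y: "y \<in> \<Union>es" "y \<in> A" "{y, q} \<in> edges G"
    using bipartite_edge_set.adjacent_to_es[OF sides_swapped assms(2)] by (auto simp: insert_commute)
  have "(\<lambda>a b. {a, b} \<in> es)\<^sup>*\<^sup>* x y"
    using conn x(1) y(1) by (auto simp: connected_graph_def edge_subgraph_def)
  then obtain xs where "rtrancl_path (\<lambda>a b. {a, b} \<in> es) x xs y"
    by (auto simp: rtranclp_eq_rtrancl_path)
  then obtain ys where "rtrancl_path (\<lambda>a b. {a, b} \<in> es) x ys y" "distinct (x # ys)"
    by (rule rtrancl_path_distinct)
  then show ?thesis
    using finite_es es es_cross AB(2) x y by (intro alternating_path_exchange[of es x ys y]) auto
qed

text \<open>
  Every edge of \<open>es\<close> has one end in \<open>B\<close>, so the degree of the monomial in \<open>T = B \<inter> \<Union>es\<close> is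
  \<open>card es\<close>, one less than the number of edges dividing it. Hence some edge inside the support avoids \<open>T\<close>. It
  cannot have an end in \<open>A \<inter> \<Union>es\<close>: its other end would lie in \<open>N[es]\<close>, hence in the support
  within \<open>A\<close>, against bipartiteness. So it is an edge of \<open>H\<close>.
\<close>

lemma edge_multiple_restrict:
  assumes m: "keys m \<subseteq> verts H" and a: "a \<in> A" "a \<in> \<Union>es"
    and mult: "edge_multiple (edges G) (Suc (card es)) (m + (edge_exponent es + monomial a n))"
  shows "edge_multiple (edges H) 1 m"
proof -
  define T where "T = B \<inter> \<Union>es"
  have HN: "verts H \<inter> N = {}" by (auto simp: induced_subgraph_def)
  have T: "finite T" "T \<subseteq> N" "a \<notin> T"
    using a AB N_verts G finite_subset[of T "verts G"] by (auto simp: T_def finite_simple_graph_def)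
  have "(\<Sum>v\<in>T. lookup m v) = 0"
    using m HN T by (intro sum.neutral) (auto simp: in_keys_iff subset_iff disjoint_iff)
  moreover have "(\<Sum>v\<in>T. lookup (monomial a n) v) = 0"
    using T by (intro sum.neutral) (auto simp: lookup_single when_def)
  moreover have "(\<Sum>v\<in>T. lookup (edge_exponent es) v) = card es"
  proof (rule degree_edge_exponent[OF finite_es T(1)])
    fix e assume e: "e \<in> es"
    then obtain a b where ab: "a \<in> A" "b \<in> B" "e = {a, b}" using es_cross by blast
    then have "e \<inter> T = {b}" using e AB(2) by (auto simp: T_def)
    then show "finite e \<and> card (e \<inter> T) = 1" using ab by simp
  qed
  ultimately have "(\<Sum>v\<in>T. lookup (m + (edge_exponent es + monomial a n)) v) = card es"
    by (simp add: lookup_add sum.distrib)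
  then obtain e where e: "e \<in> edges G" "e \<subseteq> keys (m + (edge_exponent es + monomial a n))" "e \<inter> T = {}"
    using edge_multiple_degree[OF T(1) mult] by auto
  have "keys (monomial a n) \<subseteq> {a}" by simp
  have sub: "e \<subseteq> keys m \<union> (A \<inter> \<Union>es)"
  proof
    fix w assume w: "w \<in> e"
    then have "w \<in> keys m \<or> w \<in> \<Union>es"
      using e(2) keys_edge_exponent[of es] \<open>keys (monomial a n) \<subseteq> {a}\<close> a(2) unfolding keys_add_nat by auto
    moreover have "w \<in> A" if "w \<in> \<Union>es"
      using that w e(3) AB(1) Union_es_N by (auto simp: T_def)
    ultimately show "w \<in> keys m \<union> (A \<inter> \<Union>es)" by blast
  qed
  have "card e = 2" using e(1) G unfolding finite_simple_graph_def by blast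
  then obtain u v where uv: "e = {u, v}" "u \<noteq> v" unfolding card_2_iff by blast
  have no: "False" if "x \<in> A" "x \<in> \<Union>es" "{x, y} = e" for x y
  proof -
    have "y \<in> N" using nbhd[OF that(2)] that(3) e(1) by auto
    then have "y \<in> A" using sub that(3) m HN by blast
    moreover have "\<exists>a\<in>A. \<exists>b\<in>B. e = {a, b}"
      using bip[OF e(1)] that Union_es_N \<open>y \<in> N\<close> by blast
    ultimately show False using that AB(2) by (auto simp: doubleton_eq_iff)
  qed
  have e_keys: "u \<in> keys m" "v \<in> keys m"
    using no[of u v] no[of v u] sub uv by auto
  have "{u, v} \<in> edges H"
    using e(1) uv e_keys m by (auto simp: induced_subgraph_def)
  moreover have "m = dirac u + dirac v + (m - dirac u - dirac v)"
  proof (rule poly_mapping_eqI)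
    fix w
    show "lookup m w = lookup (dirac u + dirac v + (m - dirac u - dirac v)) w"
      using e_keys uv(2) by (auto simp: lookup_add lookup_minus lookup_single when_def in_keys_iff)
  qed
  ultimately show ?thesis unfolding edge_multiple_one_iff by blast
qed

lemma H_simple: "finite_simple_graph H"
  using G by (auto simp: finite_simple_graph_def induced_subgraph_def)

text \<open>
  The suspension argument applies with \<open>f\<close> the product of the edges in \<open>es\<close>, and with endpoints
  \<open>a \<in> A\<close> and \<open>b \<in> B\<close> of such edges as apexes.
\<close>

proposition has_class_edge_ideal_power:
  assumes cls: "has_class (poly_set (verts H)) (edge_ideal H :: ('v, 'k::comm_ring_1) mpolynomial set)
      (verts H) variable posW p"
    and pos: "inj_on posW (verts H)" "inj_on posV (verts G)"
  shows "has_class (poly_set (verts G))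
      (edge_ideal G [^]\<^bsub>ideals_set (polynomial_ring (verts G) :: ('v, 'k) mpolynomial ring)\<^esub> (card es + 1))
      (verts G) variable posV (Suc p)"
proof -
  let ?K = "edge_ideal H :: ('v, 'k) mpolynomial set"
  let ?J = "edge_ideal G [^]\<^bsub>ideals_set (polynomial_ring (verts G) :: ('v, 'k) mpolynomial ring)\<^esub> (card es + 1)"
  let ?F = "edge_exponent es"
  let ?f = "monomial ?F 1 :: ('v, 'k) mpolynomial"
  note K = edge_ideal_eq[OF H_simple, where 'k = 'k]
  note J = edge_ideal_power_eq[OF G, where 'k = 'k, of "card es + 1"]
  obtain a where a: "a \<in> A" "a \<in> \<Union>es" using exists_endpoint by blast
  obtain b where b: "b \<in> B" "b \<in> \<Union>es" using bipartite_edge_set.exists_endpoint[OF sides_swapped] by blast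
  have HV: "verts H = verts G - N" by (auto simp: induced_subgraph_def)
  have F_N: "keys ?F \<subseteq> N" by (rule order_trans[OF keys_edge_exponent Union_es_N])
  define P :: "'v \<Rightarrow> nat \<Rightarrow> ('v, 'k) mpolynomial \<Rightarrow> ('v, 'k) mpolynomial"
    where "P c n = coeff_at (verts H) (?F + monomial c n)" for c n
  have qK: "quotient_of_subring (poly_set (verts H)) ?K"
    unfolding K by (rule quotient_of_subring_monomial) (simp add: edge_multiple_add)
  have qJ: "quotient_of_subring (poly_set (verts G)) ?J"
    unfolding J by (rule quotient_of_subring_monomial) (simp add: edge_multiple_add)
  have sub: "poly_set (verts H) \<subseteq> (poly_set (verts G) :: ('v, 'k) mpolynomial set)"
    by (auto simp: poly_set_def HV)
  have var: "variable v \<in> (poly_set W :: ('v, 'k) mpolynomial set)" if "v \<in> W" for v W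
    using that by (simp add: poly_set_def variable_def)
  have fG: "?f \<in> poly_set (verts G)" using F_N N_verts by (auto simp: poly_set_def)
  have fK: "?f * k \<in> ?J" if k: "k \<in> ?K" for k
  proof -
    have "?f * k \<in> poly_set (verts G)"
      using k sub by (intro quotient_of_subring.mult_C[OF qJ] fG) (auto simp: K monomial_ideal_def)
    moreover have "edge_multiple (edges G) (card es + 1) m" if m: "m \<in> keys (?f * k)" for m
    proof -
      obtain m' where m': "m' \<in> keys k" "m = ?F + m'"
        using m keys_mult[of ?f k] by auto
      then have "edge_multiple (edges H) 1 m'" using k unfolding K monomial_ideal_def by blast
      moreover have "edges H \<subseteq> edges G" by (auto simp: induced_subgraph_def)
      ultimately have "edge_multiple (edges G) 1 m'" by (rule edge_multiple_mono[rotated])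
      moreover have "edge_multiple (edges G) (card es) ?F"
        using G es by (intro edge_multiple_edge_exponent finite_es) (auto simp: finite_simple_graph_def)
      ultimately show ?thesis unfolding m'(2) by (intro edge_multiple_plus)
    qed
    ultimately show ?thesis unfolding J by (simp add: monomial_ideal_def subset_iff)
  qed
  have cross: "variable p * variable q * ?f \<in> ?J" if "p \<in> A" "q \<in> B" for p q
  proof -
    have "p \<in> verts G" "q \<in> verts G" using that AB N_verts by auto
    then show ?thesis
      unfolding J variable_mult_single using edge_multiple_cross[OF that] F_N N_verts
      by (auto simp: monomial_ideal_def poly_set_def keys_add_nat)
  qed
  interpret suspension "poly_set (verts H)" ?K "poly_set (verts G)" ?J variable "verts H" "verts G" A B a b ?f
    P posW posV
  proof (intro suspension.intro suspension_axioms.intro qK qJ fG fK cross sub var pos AB(2) a(1) b(1))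
    show "finite (verts G)" using G by (simp add: finite_simple_graph_def)
    show "verts G = verts H \<union> (A \<union> B)" "verts H \<inter> (A \<union> B) = {}" unfolding AB HV using N_verts by auto
    show "P c n s \<in> poly_set (verts H)" for c n s unfolding P_def by (rule coeff_at_poly_set)
    show "P c n (s + s') = P c n s + P c n s'" for c n s s' unfolding P_def by (rule coeff_at_add)
    show "P c n (r * s) = r * P c n s" if "c = a \<or> c = b" "r \<in> poly_set (verts H)" for c n r s
    proof -
      have "c \<in> N" using that(1) a(2) b(2) Union_es_N by blast
      moreover have "keys (monomial c n) \<subseteq> {c}" by simp
      ultimately have "keys (?F + monomial c n) \<subseteq> N" using F_N unfolding keys_add_nat by blast
      then have "keys (?F + monomial c n) \<inter> verts H = {}" using HV by blast
      then show ?thesis unfolding P_def by (rule coeff_at_mult[OF that(2)])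
    qed
    show "P c (n + m) (variable c ^ m * s) = P c n s" for c n m s
      unfolding P_def variable_power using coeff_at_shift[of "verts H" "?F + monomial c n" "monomial c m" s]
      by (simp add: single_add add.assoc)
    show "P a 0 s = P b 0 s" for s by (simp add: P_def)
    show "P a 0 ?f = 1" by (simp add: P_def coeff_at_self)
    show "P c n s \<in> ?K" if c: "c = a \<or> c = b" and s: "s \<in> ?J" for c n s
    proof -
      have "edge_multiple (edges H) 1 m" if "m \<in> keys (P c n s)" for m
      proof -
        have m: "keys m \<subseteq> verts H" "m + (?F + monomial c n) \<in> keys s"
          using that by (auto simp: P_def in_keys_iff lookup_coeff_at)
        then have "edge_multiple (edges G) (Suc (card es)) (m + (?F + monomial c n))"
          using s unfolding J monomial_ideal_def by auto
        then show ?thesis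
          using c m(1) a b edge_multiple_restrict bipartite_edge_set.edge_multiple_restrict[OF sides_swapped] by blast
      qed
      then show ?thesis
        unfolding K using coeff_at_poly_set[of "verts H" _ s]
        by (auto simp: monomial_ideal_def P_def)
    qed
  qed
  show ?thesis using has_class_suspension[OF cls] .
qed

end

section \<open>The depth bound\<close>

theorem lemma1p2:
  fixes G H :: "'v graph"
    and es :: "'v set set"
    and t :: nat
    and S R :: "('v, 'k::field) mpolynomial ring"
  assumes "finite_simple_graph G"
    and "t \<ge> 1"
    and "es \<subseteq> edges G"
    and "card es = t"
    and "bipartite (induced_subgraph G (closed_nbhd_edges G es))"
    and "H = induced_subgraph G (verts G - closed_nbhd_edges G es)"
    and "weakly_chordal H"
    and "connected_graph (edge_subgraph es)"
    and "S = polynomial_ring (verts G)"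
    and "R = polynomial_ring (verts H)"
  shows "polynomial_depth (verts G)
           (quotient_module (regular_module S) (edge_ideal G [^]\<^bsub>ideals_set S\<^esub> (t + 1)))
         \<le> 1 + polynomial_depth (verts H)
           (quotient_module (regular_module R) (edge_ideal H))"
proof -
  let ?N = "closed_nbhd_edges G es"
  obtain A B where AB: "A \<union> B = verts (induced_subgraph G ?N)" "A \<inter> B = {}"
    "\<forall>e\<in>edges (induced_subgraph G ?N). \<exists>a\<in>A. \<exists>b\<in>B. e = {a, b}"
    using assms(5) unfolding bipartite_def by blast
  have "es \<noteq> {}" using assms(2,4) by auto
  have "?N \<subseteq> verts G"
    using assms(1,3) unfolding finite_simple_graph_def closed_nbhd_edges_def closed_nbhd_def by blast
  then interpret bipartite_edge_set G es A B
    using assms(1,3,8) AB \<open>es \<noteq> {}\<close> by unfold_locales (auto simp: induced_subgraph_def)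
  have H: "H = induced_subgraph G (verts G - ?N)" by (fact assms(6))
  have fin: "finite (verts G)" "finite (verts H)"
    using assms(1) H_simple H by (auto simp: finite_simple_graph_def)
  let ?J = "edge_ideal G [^]\<^bsub>ideals_set (polynomial_ring (verts G) :: ('v, 'k) mpolynomial ring)\<^esub> (t + 1)"
  let ?K = "edge_ideal H :: ('v, 'k) mpolynomial set"
  have "quotient_of_subring (poly_set (verts G)) ?J"
    unfolding edge_ideal_power_eq[OF assms(1)]
    by (rule quotient_of_subring_monomial) (simp add: edge_multiple_add)
  then obtain posV where posV: "inj_on posV (verts G)" and depthG:
    "polynomial_depth (verts G) (quotient_module (regular_module (polynomial_ring (verts G))) ?J)
      = Inf {enat i | i. has_class (poly_set (verts G)) ?J (verts G) variable posV i}"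
    using polynomial_depth_has_class[OF fin(1)] by blast
  have "quotient_of_subring (poly_set (verts H)) ?K"
    unfolding edge_ideal_eq[OF H_simple[folded H]]
    by (rule quotient_of_subring_monomial) (simp add: edge_multiple_add)
  then obtain posW where posW: "inj_on posW (verts H)" and depthH:
    "polynomial_depth (verts H) (quotient_module (regular_module (polynomial_ring (verts H))) ?K)
      = Inf {enat i | i. has_class (poly_set (verts H)) ?K (verts H) variable posW i}"
    using polynomial_depth_has_class[OF fin(2)] by blast
  let ?D = "{enat i | i. has_class (poly_set (verts H)) ?K (verts H) variable posW i}"
  have "polynomial_depth (verts G) (quotient_module (regular_module (polynomial_ring (verts G))) ?J) \<le> 1 + Inf ?D"
  proof (cases "?D = {}")
    case True
    then show ?thesis by (simp add: top_enat_def)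
  next
    case False
    then have "Inf ?D \<in> ?D" by (auto simp: Inf_enat_def intro: LeastI)
    then obtain i where i: "Inf ?D = enat i" "has_class (poly_set (verts H)) ?K (verts H) variable posW i"
      by auto
    have "has_class (poly_set (verts G)) ?J (verts G) variable posV (Suc i)"
      using has_class_edge_ideal_power[OF i(2)[unfolded H] posW[unfolded H] posV] assms(4) by simp
    then have "polynomial_depth (verts G) (quotient_module (regular_module (polynomial_ring (verts G))) ?J) \<le> enat (Suc i)"
      unfolding depthG by (intro Inf_lower) auto
    then show ?thesis using i(1) by (simp add: one_enat_def)
  qed
  then show ?thesis unfolding assms(9,10) depthH .
qed

end
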